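(* Consider the problem of minimizing energy of a feasible non-preemptive schedule on $m\ge1$ speed-scalable processors for clique instances. Algorithm Cl, described below, is a $(2(2-\frac{1}{m}))^{\alpha-1}$-approximation algorithm for this problem. Algorithm Cl: (1) compute an optimal preemptive schedule with migration $\mathcal{S}_{pr}$ for the instance; (2) let $T=\min_j d_j$, and for each job $J_j$ let $e_{\ell j}$ and $e_{rj}$ be the total time during which $J_j$ is executed in $\mathcal{S}_{pr}$ before $T$ and after $T$, respectively; (3) let $\mathbb{L}=\{J_j: e_{\ell j}\ge e_{rj}\}$ and $\mathbb{R}=\{J_j: e_{\ell j}<e_{rj}\}$; (4) form the instance $\mathcal{I}_{\mathbb{L}}$ of the jobs in $\mathbb{L}$ with their original works and release dates and with all deadlines set to $T$, and apply algorithm CD to it; (5) form the instance $\mathcal{I}_{\mathbb{R}}$ of the jobs in $\mathbb{R}$ with their original works and deadlines and with all release dates set to $T$, and apply algorithm CRD to it (with time $T$ playing the role of the common release date); (6) return the union (concatenation) of the two resulting non-preemptive schedules. Algorithm CRD (for a common release date $R$): compute an optimal preemptive schedule with migration, let $e_j$ be the total execution time of $J_j$ in it, set $p_j=e_j/(2-\frac1m)$, and starting at time $R$ schedule jobs non-preemptively by Earliest Deadline First (whenever a processor becomes idle, start on it the unscheduled job with smallest deadline), each job run at constant speed $w_j/p_j$. Algorithm CD (for a common deadline $D$): same $p_j$, but schedule backwards from $D$ by Latest Release Date First (going backwards from $D$, whenever a processor becomes free, place on it the unscheduled job with largest release date so that it completes at that time), each job run at speed $w_j/p_j$.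
   Context: There are $m$ identical processors, each able to run at a variable speed; running at speed $s$ consumes power $s^{\alpha}$, where $\alpha>1$ is a constant; energy is power integrated over time, so a job of work $w$ run at constant speed $s$ consumes energy $w s^{\alpha-1}$. A job $J_j$ has work $w_j>0$, release date $r_j$ and deadline $d_j>r_j$. An instance is a clique instance if for any two jobs $J_j,J_{j'}$ with $r_j\le r_{j'}$ we have $d_j\ge r_{j'}$ (equivalently, all active intervals $[r_j,d_j]$ share a common point). A feasible non-preemptive schedule assigns each job to a single processor and executes it without interruption during a time interval contained in $[r_j,d_j]$, processing exactly $w_j$ units of work (work is the integral of speed), with each processor executing at most one job at a time. A preemptive schedule with migration may interrupt a job and resume it later, possibly on a different processor, but never runs a job on two processors at the same time, and each job's work must be processed within $[r_j,d_j]$. An optimal preemptive schedule with migration can be computed in polynomial time (known result). A $\rho$-approximation algorithm is a polynomial-time algorithm returning a feasible non-preemptive schedule of total energy at most $\rho$ times the minimum energy of a feasible non-preemptive schedule for the same instance. *)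

theory Defs
  imports "HOL-Analysis.Analysis" "HOL-Library.Time_Functions"
begin

section \<open>Instances\<close>

record job =
  jid :: nat
  work :: real
  release :: real
  deadline :: real

definition valid_instance :: "job list \<Rightarrow> bool" where
  "valid_instance I \<longleftrightarrow>
     distinct (map jid I) \<and> (\<forall>j\<in>set I. 0 < work j \<and> release j < deadline j)"

definition clique_instance :: "job list \<Rightarrow> bool" where
  "clique_instance I \<longleftrightarrow>
     (\<forall>j\<in>set I. \<forall>j'\<in>set I. release j \<le> release j' \<longrightarrow> release j' \<le> deadline j)"


section \<open>Schedules\<close>

text \<open>\<open>S k i t\<close> is the speed at which processor \<open>i\<close> executes the job with identifier \<open>k\<close> at
  time \<open>t\<close>; it is \<open>0\<close> iff the job is not being executed there. The processors are \<open>{..<m}\<close>.\<close>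

type_synonym schedule = "nat \<Rightarrow> nat \<Rightarrow> real \<Rightarrow> real"

definition preemptive_feasible :: "nat \<Rightarrow> job list \<Rightarrow> schedule \<Rightarrow> bool" where
  "preemptive_feasible m I S \<longleftrightarrow>
     (\<forall>k i. S k i \<in> borel_measurable borel) \<and>
     (\<forall>k i t. 0 \<le> S k i t) \<and>
     (\<forall>k i t. 0 < S k i t \<longrightarrow>
        i < m \<and> (\<exists>j\<in>set I. jid j = k \<and> release j \<le> t \<and> t \<le> deadline j)) \<and>
     (\<forall>i t k k'. 0 < S k i t \<longrightarrow> 0 < S k' i t \<longrightarrow> k = k') \<and>
     (\<forall>k t i i'. 0 < S k i t \<longrightarrow> 0 < S k i' t \<longrightarrow> i = i') \<and>
     (\<forall>j\<in>set I. (\<Sum>i<m. \<integral>\<^sup>+t. ennreal (S (jid j) i t) \<partial>lborel) = ennreal (work j))"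

definition nonpreemptive_feasible :: "nat \<Rightarrow> job list \<Rightarrow> schedule \<Rightarrow> bool" where
  "nonpreemptive_feasible m I S \<longleftrightarrow>
     preemptive_feasible m I S \<and>
     (\<forall>j\<in>set I. \<exists>i<m. is_interval {t. 0 < S (jid j) i t} \<and>
        (\<forall>i'. i' \<noteq> i \<longrightarrow> (\<forall>t. S (jid j) i' t = 0)))"

text \<open>In a feasible schedule at most one summand of the inner sum is nonzero, so the sum is the
  speed of processor \<open>i\<close> at time \<open>t\<close>. Energies are extended nonnegative reals, so that a schedule
  may have infinite energy.\<close>

definition energy :: "real \<Rightarrow> nat \<Rightarrow> job list \<Rightarrow> schedule \<Rightarrow> ennreal" where
  "energy \<alpha> m I S =
     (\<Sum>i<m. \<integral>\<^sup>+t. ennreal ((\<Sum>j\<in>set I. S (jid j) i t) powr \<alpha>) \<partial>lborel)"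

text \<open>The schedules produced by algorithms are finite lists of pieces. During
  \<open>{start p..<finish p}\<close> processor \<open>proc p\<close> executes job \<open>pjob p\<close> at constant speed.\<close>

record piece =
  pjob :: nat
  proc :: nat
  start :: real
  finish :: real
  pspeed :: real

definition schedule_of :: "piece list \<Rightarrow> schedule" where
  "schedule_of ps k i t =
     (\<Sum>p\<leftarrow>ps. if pjob p = k \<and> proc p = i \<and> start p \<le> t \<and> t < finish p then pspeed p else 0)"

text \<open>Pieces of the same job must not overlap; then the execution time of a job is the sum of the
  lengths of its pieces. Overlaps of different jobs on a processor are excluded by feasibility.\<close>

definition well_formed :: "piece list \<Rightarrow> bool" where
  "well_formed ps \<longleftrightarrow>
     (\<forall>p\<in>set ps. start p < finish p \<and> 0 < pspeed p) \<and>
     sorted_wrt (\<lambda>p q. pjob p = pjob q \<longrightarrow> finish p \<le> start q \<or> finish q \<le> start p) ps"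


section \<open>Approximation algorithms\<close>

text \<open>An algorithm receives the number of processors and the instance. It is given by its result
  \<open>A m I\<close> together with its number of elementary steps \<open>T_A m I\<close> in the unit-cost model over the
  reals, in which the size of the input is proportional to the number of jobs plus one.\<close>

type_synonym algorithm = "nat \<Rightarrow> job list \<Rightarrow> piece list"
type_synonym running_time = "nat \<Rightarrow> job list \<Rightarrow> nat"

definition polynomial_time :: "(job list \<Rightarrow> bool) \<Rightarrow> algorithm \<Rightarrow> running_time \<Rightarrow> bool" where
  "polynomial_time P A T_A \<longleftrightarrow>
     (\<exists>c d. \<forall>m I. 1 \<le> m \<longrightarrow> valid_instance I \<longrightarrow> P I \<longrightarrow>
        T_A m I + length (A m I) \<le> c * (length I + 1) ^ d)"

definition optimal_preemptive_algorithm :: "real \<Rightarrow> algorithm \<Rightarrow> running_time \<Rightarrow> bool" where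
  "optimal_preemptive_algorithm \<alpha> A T_A \<longleftrightarrow>
     polynomial_time (\<lambda>_. True) A T_A \<and>
     (\<forall>m I. 1 \<le> m \<longrightarrow> valid_instance I \<longrightarrow>
        well_formed (A m I) \<and>
        preemptive_feasible m I (schedule_of (A m I)) \<and>
        (\<forall>S. preemptive_feasible m I S \<longrightarrow>
           energy \<alpha> m I (schedule_of (A m I)) \<le> energy \<alpha> m I S))"

definition approximation_algorithm ::
  "real \<Rightarrow> (job list \<Rightarrow> bool) \<Rightarrow> (nat \<Rightarrow> real) \<Rightarrow> algorithm \<Rightarrow> running_time \<Rightarrow> bool" where
  "approximation_algorithm \<alpha> P \<rho> A T_A \<longleftrightarrow>
     polynomial_time P A T_A \<and>
     (\<forall>m I. 1 \<le> m \<longrightarrow> valid_instance I \<longrightarrow> P I \<longrightarrow>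
        well_formed (A m I) \<and>
        nonpreemptive_feasible m I (schedule_of (A m I)) \<and>
        (\<forall>S. nonpreemptive_feasible m I S \<longrightarrow>
           energy \<alpha> m I (schedule_of (A m I)) \<le> ennreal (\<rho> m) * energy \<alpha> m I S))"


section \<open>The algorithms\<close>

text \<open>\<open>opt\<close> is the subroutine computing optimal preemptive schedules with migration. Lists of type
  \<open>(real \<times> nat) list\<close> are queues of processors with the times at which they become free, the next
  one to become free in front.\<close>

fun exec_time :: "nat \<Rightarrow> piece list \<Rightarrow> real" where
  "exec_time k [] = 0"
| "exec_time k (p # ps) = (if pjob p = k then finish p - start p else 0) + exec_time k ps"

fun exec_before :: "real \<Rightarrow> nat \<Rightarrow> piece list \<Rightarrow> real" where
  "exec_before T k [] = 0"
| "exec_before T k (p # ps) =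
     (if pjob p = k then max 0 (min (finish p) T - start p) else 0) + exec_before T k ps"

fun exec_after :: "real \<Rightarrow> nat \<Rightarrow> piece list \<Rightarrow> real" where
  "exec_after T k [] = 0"
| "exec_after T k (p # ps) =
     (if pjob p = k then max 0 (finish p - max (start p) T) else 0) + exec_after T k ps"

definition durations :: "nat \<Rightarrow> piece list \<Rightarrow> job list \<Rightarrow> (job \<times> real) list" where
  "durations m ps js = map (\<lambda>j. (j, exec_time (jid j) ps / (2 - 1 / real m))) js"

fun processors :: "real \<Rightarrow> nat \<Rightarrow> (real \<times> nat) list" where
  "processors t 0 = []"
| "processors t (Suc i) = (t, i) # processors t i"

fun forward :: "(real \<times> nat) list \<Rightarrow> (job \<times> real) list \<Rightarrow> piece list" where
  "forward q [] = []"
| "forward [] (x # xs) = []"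
| "forward ((t, i) # q) ((j, p) # xs) =
     \<lparr>pjob = jid j, proc = i, start = t, finish = t + p, pspeed = work j / p\<rparr>
     # forward (insort_key (\<lambda>(t, i). t) (t + p, i) q) xs"

fun backward :: "(real \<times> nat) list \<Rightarrow> (job \<times> real) list \<Rightarrow> piece list" where
  "backward q [] = []"
| "backward [] (x # xs) = []"
| "backward ((t, i) # q) ((j, p) # xs) =
     \<lparr>pjob = jid j, proc = i, start = t - p, finish = t, pspeed = work j / p\<rparr>
     # backward (insort_key (\<lambda>(t, i). - t) (t - p, i) q) xs"

text \<open>If there are more processors than jobs, the surplus processors are never used.\<close>

definition crd :: "algorithm \<Rightarrow> real \<Rightarrow> algorithm" where
  "crd opt R m js =
     forward (processors R (min m (length js)))
       (sort_key (\<lambda>(j, p). deadline j) (durations m (opt m js) js))"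

definition cd :: "algorithm \<Rightarrow> real \<Rightarrow> algorithm" where
  "cd opt D m js =
     backward (processors D (min m (length js)))
       (sort_key (\<lambda>(j, p). - release j) (durations m (opt m js) js))"

fun min_deadline :: "job list \<Rightarrow> real" where
  "min_deadline [] = 0"
| "min_deadline [j] = deadline j"
| "min_deadline (j # j' # js) = min (deadline j) (min_deadline (j' # js))"

definition left_jobs :: "real \<Rightarrow> piece list \<Rightarrow> job list \<Rightarrow> job list" where
  "left_jobs T ps I = filter (\<lambda>j. exec_before T (jid j) ps \<ge> exec_after T (jid j) ps) I"

definition right_jobs :: "real \<Rightarrow> piece list \<Rightarrow> job list \<Rightarrow> job list" where
  "right_jobs T ps I = filter (\<lambda>j. exec_before T (jid j) ps < exec_after T (jid j) ps) I"

definition left_instance :: "real \<Rightarrow> piece list \<Rightarrow> job list \<Rightarrow> job list" where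
  "left_instance T ps I = map (\<lambda>j. j\<lparr>deadline := T\<rparr>) (left_jobs T ps I)"

definition right_instance :: "real \<Rightarrow> piece list \<Rightarrow> job list \<Rightarrow> job list" where
  "right_instance T ps I = map (\<lambda>j. j\<lparr>release := T\<rparr>) (right_jobs T ps I)"

definition cl :: "algorithm \<Rightarrow> algorithm" where
  "cl opt m I =
     (let T = min_deadline I; ps = opt m I
      in cd opt T m (left_instance T ps I) @ crd opt T m (right_instance T ps I))"


section \<open>Running times\<close>

text \<open>These functions follow the translation scheme of theory \<open>HOL-Library.Time_Commands\<close>: every
  function call costs one step plus the cost of evaluating its arguments and its body, while
  constructors, selectors, record updates, arithmetic operations and comparisons of numbers are
  absorbed in the cost of the surrounding call. Evaluating a sort key is such a constant-time
  operation. The cost of the subroutine \<open>opt\<close> is \<open>T_opt\<close>.\<close>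

fun T_exec_time :: "nat \<Rightarrow> piece list \<Rightarrow> nat" where
  "T_exec_time k [] = 1"
| "T_exec_time k (p # ps) = T_exec_time k ps + 1"

fun T_exec_before :: "real \<Rightarrow> nat \<Rightarrow> piece list \<Rightarrow> nat" where
  "T_exec_before T k [] = 1"
| "T_exec_before T k (p # ps) = T_exec_before T k ps + 1"

fun T_exec_after :: "real \<Rightarrow> nat \<Rightarrow> piece list \<Rightarrow> nat" where
  "T_exec_after T k [] = 1"
| "T_exec_after T k (p # ps) = T_exec_after T k ps + 1"

definition T_durations :: "nat \<Rightarrow> piece list \<Rightarrow> job list \<Rightarrow> nat" where
  "T_durations m ps js = T_map (\<lambda>j. T_exec_time (jid j) ps) js + 1"

fun T_processors :: "real \<Rightarrow> nat \<Rightarrow> nat" where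
  "T_processors t 0 = 1"
| "T_processors t (Suc i) = T_processors t i + 1"

fun T_insort_key :: "('a \<Rightarrow> real) \<Rightarrow> 'a \<Rightarrow> 'a list \<Rightarrow> nat" where
  "T_insort_key f x [] = 1"
| "T_insort_key f x (y # ys) = (if f x \<le> f y then 0 else T_insort_key f x ys) + 1"

fun T_sort_key :: "('a \<Rightarrow> real) \<Rightarrow> 'a list \<Rightarrow> nat" where
  "T_sort_key f [] = 1"
| "T_sort_key f (x # xs) = T_sort_key f xs + T_insort_key f x (sort_key f xs) + 1"

fun T_forward :: "(real \<times> nat) list \<Rightarrow> (job \<times> real) list \<Rightarrow> nat" where
  "T_forward q [] = 1"
| "T_forward [] (x # xs) = 1"
| "T_forward ((t, i) # q) ((j, p) # xs) =
     T_insort_key (\<lambda>(t, i). t) (t + p, i) q +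
     T_forward (insort_key (\<lambda>(t, i). t) (t + p, i) q) xs + 1"

fun T_backward :: "(real \<times> nat) list \<Rightarrow> (job \<times> real) list \<Rightarrow> nat" where
  "T_backward q [] = 1"
| "T_backward [] (x # xs) = 1"
| "T_backward ((t, i) # q) ((j, p) # xs) =
     T_insort_key (\<lambda>(t, i). - t) (t - p, i) q +
     T_backward (insort_key (\<lambda>(t, i). - t) (t - p, i) q) xs + 1"

definition T_crd :: "algorithm \<Rightarrow> running_time \<Rightarrow> real \<Rightarrow> running_time" where
  "T_crd opt T_opt R m js =
     (let ps = opt m js; xs = durations m ps js
      in T_opt m js + T_durations m ps js + T_sort_key (\<lambda>(j, p). deadline j) xs +
         T_length js + T_processors R (min m (length js)) +
         T_forward (processors R (min m (length js))) (sort_key (\<lambda>(j, p). deadline j) xs) + 1)"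

definition T_cd :: "algorithm \<Rightarrow> running_time \<Rightarrow> real \<Rightarrow> running_time" where
  "T_cd opt T_opt D m js =
     (let ps = opt m js; xs = durations m ps js
      in T_opt m js + T_durations m ps js + T_sort_key (\<lambda>(j, p). - release j) xs +
         T_length js + T_processors D (min m (length js)) +
         T_backward (processors D (min m (length js))) (sort_key (\<lambda>(j, p). - release j) xs) + 1)"

fun T_min_deadline :: "job list \<Rightarrow> nat" where
  "T_min_deadline [] = 1"
| "T_min_deadline [j] = 1"
| "T_min_deadline (j # j' # js) = T_min_deadline (j' # js) + 1"

definition T_left_jobs :: "real \<Rightarrow> piece list \<Rightarrow> job list \<Rightarrow> nat" where
  "T_left_jobs T ps I =
     T_filter (\<lambda>j. T_exec_before T (jid j) ps + T_exec_after T (jid j) ps) I + 1"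

definition T_right_jobs :: "real \<Rightarrow> piece list \<Rightarrow> job list \<Rightarrow> nat" where
  "T_right_jobs T ps I =
     T_filter (\<lambda>j. T_exec_before T (jid j) ps + T_exec_after T (jid j) ps) I + 1"

definition T_left_instance :: "real \<Rightarrow> piece list \<Rightarrow> job list \<Rightarrow> nat" where
  "T_left_instance T ps I = T_left_jobs T ps I + T_map (\<lambda>j. 0) (left_jobs T ps I) + 1"

definition T_right_instance :: "real \<Rightarrow> piece list \<Rightarrow> job list \<Rightarrow> nat" where
  "T_right_instance T ps I = T_right_jobs T ps I + T_map (\<lambda>j. 0) (right_jobs T ps I) + 1"

definition T_cl :: "algorithm \<Rightarrow> running_time \<Rightarrow> running_time" where
  "T_cl opt T_opt m I =
     (let T = min_deadline I; ps = opt m I;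
          IL = left_instance T ps I; IR = right_instance T ps I
      in T_min_deadline I + T_opt m I +
         T_left_instance T ps I + T_right_instance T ps I +
         T_cd opt T_opt T m IL + T_crd opt T_opt T m IR +
         T_append (cd opt T m IL) (crd opt T m IR) + 1)"

end

theory Submission
  imports Defs
begin

text \<open>
  The execution time of a job in a preemptive schedule is the Lebesgue measure of the set of times
  at which the job is running. By convexity of \<open>s \<mapsto> s powr \<alpha>\<close>, a job of work \<open>w\<close> that runs for
  time \<open>e\<close> costs at least \<open>w * (w / e) powr (\<alpha> - 1)\<close>, with equality at constant speed. Hence dividing
  execution times by a factor \<open>c\<close> costs a factor of at most \<open>c powr (\<alpha> - 1)\<close>.

  This is applied twice. Confining each job to the side of \<open>T\<close> on which the optimal preemptive schedule
  runs it at least half of its time gives preemptive schedules of the left and right instances and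
  accounts for the factor 2. List scheduling with the execution times shortened by \<open>2 - 1 / m\<close>
  accounts for the other factor: the jobs preceding \<open>j\<close> in the list, together with \<open>j\<close>, need total
  time at most \<open>m * (d - R) / (2 - 1 / m)\<close>, where \<open>d\<close> is the due date of \<open>j\<close>, because they all have to
  be executed in \<open>{R..d}\<close>; so Graham's bound lets \<open>j\<close> finish by \<open>d\<close>. Scheduling backwards from a
  common deadline is the mirror image.
\<close>

section \<open>Execution times as measures\<close>

definition active :: "schedule \<Rightarrow> nat \<Rightarrow> nat \<Rightarrow> real set" where
  "active S k i = {t. 0 < S k i t}"

definition busy :: "nat \<Rightarrow> schedule \<Rightarrow> nat \<Rightarrow> real set" where
  "busy m S k = (\<Union>i<m. active S k i)"

definition job_energy :: "real \<Rightarrow> nat \<Rightarrow> schedule \<Rightarrow> nat \<Rightarrow> ennreal" where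
  "job_energy \<alpha> m S k = (\<Sum>i<m. \<integral>\<^sup>+t. ennreal (S k i t powr \<alpha>) \<partial>lborel)"

lemma preemptive_feasibleD:
  assumes "preemptive_feasible m I S"
  shows "S k i \<in> borel_measurable borel"
    and "0 \<le> S k i t"
    and "0 < S k i t \<Longrightarrow> i < m"
    and "0 < S k i t \<Longrightarrow> \<exists>j\<in>set I. jid j = k \<and> release j \<le> t \<and> t \<le> deadline j"
    and "0 < S k i t \<Longrightarrow> 0 < S k' i t \<Longrightarrow> k = k'"
    and "0 < S k i t \<Longrightarrow> 0 < S k i' t \<Longrightarrow> i = i'"
    and "j \<in> set I \<Longrightarrow> (\<Sum>i<m. \<integral>\<^sup>+t. ennreal (S (jid j) i t) \<partial>lborel) = ennreal (work j)"
  using assms unfolding preemptive_feasible_def by metis+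

lemma valid_instanceD:
  assumes "valid_instance I"
  shows "j \<in> set I \<Longrightarrow> 0 < work j"
    and "j \<in> set I \<Longrightarrow> release j < deadline j"
    and "j \<in> set I \<Longrightarrow> j' \<in> set I \<Longrightarrow> jid j = jid j' \<Longrightarrow> j = j'"
    and "distinct (map jid I)"
    and "inj_on jid (set I)"
  using assms unfolding valid_instance_def by (auto simp: distinct_map inj_on_def)

lemma active_measurable [measurable]:
  assumes "preemptive_feasible m I S"
  shows "active S k i \<in> sets borel"
proof -
  have [measurable]: "S k i \<in> borel_measurable borel"
    using preemptive_feasibleD(1)[OF assms] .
  show ?thesis unfolding active_def by measurable
qed

lemma busy_measurable:
  assumes "preemptive_feasible m I S"
  shows "busy m S k \<in> sets borel"
  unfolding busy_def using active_measurable[OF assms] by auto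

lemma disjoint_family_active:
  assumes "preemptive_feasible m I S"
  shows "disjoint_family_on (\<lambda>i. active S k i \<inter> B) A"
  unfolding disjoint_family_on_def active_def
  using preemptive_feasibleD(6)[OF assms] by blast

lemma active_subset_window:
  assumes "valid_instance I" "preemptive_feasible m I S" "j \<in> set I"
  shows "active S (jid j) i \<subseteq> {release j..deadline j}"
  unfolding active_def
  using preemptive_feasibleD(4)[OF assms(2)] valid_instanceD(3)[OF assms(1,3)] by fastforce

lemma busy_subset_window:
  assumes "valid_instance I" "preemptive_feasible m I S" "j \<in> set I"
  shows "busy m S (jid j) \<subseteq> {release j..deadline j}"
  unfolding busy_def using active_subset_window[OF assms] by blast

text \<open>A job never runs on two processors at once, so the sets united in \<open>busy\<close>
  are disjoint; the bounded window of the job supplies the finite measures that additivity needs.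
  The set \<open>B\<close> will be the times before or after the split point.\<close>

lemma measure_busy_Int:
  assumes "valid_instance I" "preemptive_feasible m I S" "j \<in> set I" and B: "B \<in> sets borel"
  shows "measure lborel (busy m S (jid j) \<inter> B) = (\<Sum>i<m. measure lborel (active S (jid j) i \<inter> B))"
proof -
  have fin: "emeasure lborel (active S (jid j) i \<inter> B) \<noteq> \<infinity>" for i
    using emeasure_bounded_finite[of "active S (jid j) i \<inter> B"]
      bounded_subset[OF bounded_closed_interval active_subset_window[OF assms(1-3), of i]]
    by (simp add: bounded_Int)
  have "busy m S (jid j) \<inter> B = (\<Union>i<m. active S (jid j) i \<inter> B)"
    unfolding busy_def by blast
  moreover have "measure lborel (\<Union>i<m. active S (jid j) i \<inter> B)
      = (\<Sum>i<m. measure lborel (active S (jid j) i \<inter> B))"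
    using fin disjoint_family_active[OF assms(2)] active_measurable[OF assms(2)] B
    by (intro measure_finite_Union) auto
  ultimately show ?thesis by simp
qed

lemma measure_busy:
  assumes "valid_instance I" "preemptive_feasible m I S" "j \<in> set I"
  shows "measure lborel (busy m S (jid j)) = (\<Sum>i<m. measure lborel (active S (jid j) i))"
  using measure_busy_Int[OF assms, of UNIV] by simp

lemma fmeasurable_lborel_bounded:
  assumes "bounded A" "A \<in> sets borel"
  shows "A \<in> fmeasurable lborel"
  using assms emeasure_bounded_finite[of A] by (simp add: fmeasurable_def)

lemma measure_subset_interval:
  assumes "A \<subseteq> {a..b::real}" "A \<in> sets borel" "a \<le> b"
  shows "measure lborel A \<le> b - a"
proof -
  have "measure lborel A \<le> measure lborel {a..b}"
    using assms by (intro measure_mono_fmeasurable fmeasurable_lborel_bounded) auto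
  then show ?thesis using assms(3) by simp
qed

lemma measure_busy_le_window:
  assumes "valid_instance I" "preemptive_feasible m I S" "j \<in> set I"
  shows "measure lborel (busy m S (jid j)) \<le> deadline j - release j"
  using measure_subset_interval[OF busy_subset_window[OF assms] busy_measurable[OF assms(2)]]
    valid_instanceD(2)[OF assms(1,3)] by simp

text \<open>Capacity argument: after exchanging the sums, the jobs of \<open>J\<close> occupy
  disjoint parts of \<open>{a..b}\<close> on each processor, so each of the \<open>m\<close>
  processors contributes at most \<open>b - a\<close>.\<close>

lemma sum_measure_busy_le:
  assumes "valid_instance I" "preemptive_feasible m I S" "J \<subseteq> set I"
    and "\<And>j. j \<in> J \<Longrightarrow> a \<le> release j" "\<And>j. j \<in> J \<Longrightarrow> deadline j \<le> b" and "a \<le> b"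
  shows "(\<Sum>j\<in>J. measure lborel (busy m S (jid j))) \<le> real m * (b - a)"
proof -
  have finJ: "finite J" using assms(3) finite_subset by blast
  have act: "active S (jid j) i \<subseteq> {a..b}" if "j \<in> J" for i j
    using active_subset_window[OF assms(1,2), of j i] that assms(3,4,5) by fastforce
  have fin: "emeasure lborel (active S (jid j) i) \<noteq> \<infinity>" if "j \<in> J" for i j
    using emeasure_bounded_finite[OF bounded_subset[OF bounded_closed_interval act[OF that, of i]]]
    by simp
  have dis: "disjoint_family_on (\<lambda>j. active S (jid j) i) J" for i
    unfolding disjoint_family_on_def active_def
    using preemptive_feasibleD(5)[OF assms(2)] valid_instanceD(3)[OF assms(1)] assms(3) by blast
  have "(\<Sum>j\<in>J. measure lborel (busy m S (jid j)))
      = (\<Sum>j\<in>J. \<Sum>i<m. measure lborel (active S (jid j) i))"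
    using measure_busy[OF assms(1,2)] assms(3) by (intro sum.cong) auto
  also have "\<dots> = (\<Sum>i<m. \<Sum>j\<in>J. measure lborel (active S (jid j) i))"
    by (rule sum.swap)
  also have "\<dots> = (\<Sum>i<m. measure lborel (\<Union>j\<in>J. active S (jid j) i))"
    using fin dis active_measurable[OF assms(2)] finJ
    by (intro sum.cong refl measure_finite_Union[symmetric]) auto
  also have "\<dots> \<le> (\<Sum>i<m. b - a)"
    using act finJ active_measurable[OF assms(2)] assms(6)
    by (intro sum_mono measure_subset_interval) auto
  finally show ?thesis by simp
qed

section \<open>Execution times read off from lists of pieces\<close>

lemma schedule_of_pos_iff:
  assumes "\<forall>p\<in>set ps. 0 < pspeed p"
  shows "0 < schedule_of ps k i t \<longleftrightarrow>
    (\<exists>p\<in>set ps. pjob p = k \<and> proc p = i \<and> start p \<le> t \<and> t < finish p)"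
  using assms
proof (induction ps)
  case (Cons p ps)
  have "0 \<le> schedule_of ps k i t"
    unfolding schedule_of_def using Cons.prems by (intro sum_list_nonneg) (auto simp: less_imp_le)
  moreover have "schedule_of (p # ps) k i t =
      (if pjob p = k \<and> proc p = i \<and> start p \<le> t \<and> t < finish p then pspeed p else 0)
      + schedule_of ps k i t"
    by (simp add: schedule_of_def)
  ultimately show ?case using Cons by (auto simp: add_pos_nonneg)
qed (simp add: schedule_of_def)

lemma busy_schedule_of:
  assumes "well_formed ps" "preemptive_feasible m I (schedule_of ps)"
  shows "busy m (schedule_of ps) k = (\<Union>p\<in>{p\<in>set ps. pjob p = k}. {start p..<finish p})"
proof -
  have *: "0 < schedule_of ps k i t \<longleftrightarrow>
      (\<exists>p\<in>set ps. pjob p = k \<and> proc p = i \<and> start p \<le> t \<and> t < finish p)" for i t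
    using assms(1) by (intro schedule_of_pos_iff) (auto simp: well_formed_def)
  have "proc p < m" if "p \<in> set ps" for p
  proof -
    \<comment> \<open>A piece runs at its own start time, so feasibility bounds its processor;
      otherwise \<open>busy\<close>, which unites only the processors below \<open>m\<close>, could
      miss it.\<close>
    have "0 < schedule_of ps (pjob p) (proc p) (start p)"
      using assms(1) that by (subst schedule_of_pos_iff) (auto simp: well_formed_def)
    then show ?thesis using preemptive_feasibleD(3)[OF assms(2)] by blast
  qed
  then show ?thesis unfolding busy_def active_def * by fastforce
qed

text \<open>Well-formedness makes the pieces of one job disjoint, so their lengths add up. Taking
  \<open>B\<close> as everything, as the times before \<open>T\<close> or as the times from
  \<open>T\<close> on yields all three execution time functions.\<close>

lemma sum_measure_pieces:
  assumes "well_formed ps" "B \<in> sets borel"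
  shows "(\<Sum>p\<leftarrow>ps. if pjob p = k then measure lborel ({start p..<finish p} \<inter> B) else 0)
    = measure lborel ((\<Union>p\<in>{p\<in>set ps. pjob p = k}. {start p..<finish p}) \<inter> B)"
  using assms
proof (induction ps)
  case (Cons p ps)
  define U where "U = (\<Union>p\<in>{p\<in>set ps. pjob p = k}. {start p..<finish p}) \<inter> B"
  have wf: "well_formed ps" using Cons.prems by (simp add: well_formed_def)
  have IH: "(\<Sum>p\<leftarrow>ps. if pjob p = k then measure lborel ({start p..<finish p} \<inter> B) else 0)
      = measure lborel U"
    using Cons.IH[OF wf Cons.prems(2)] by (simp add: U_def)
  show ?case
  proof (cases "pjob p = k")
    case True
    have eq: "(\<Union>q\<in>{q\<in>set (p # ps). pjob q = k}. {start q..<finish q}) \<inter> B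
        = ({start p..<finish p} \<inter> B) \<union> U"
      using True by (auto simp: U_def)
    have "({start p..<finish p} \<inter> B) \<inter> U = {}"
      using Cons.prems(1) True by (fastforce simp: U_def well_formed_def)
    moreover have "U \<in> fmeasurable lborel"
      unfolding U_def using Cons.prems(2)
      by (intro fmeasurable_lborel_bounded bounded_Int disjI1 bounded_UN) auto
    moreover have "{start p..<finish p} \<inter> B \<in> fmeasurable lborel"
      using Cons.prems(2)
      by (intro fmeasurable_lborel_bounded bounded_Int disjI1) auto
    ultimately show ?thesis
      unfolding eq using IH True by (simp add: measure_Un3)
  next
    case False
    then have "{q\<in>set (p # ps). pjob q = k} = {q\<in>set ps. pjob q = k}" by auto
    then show ?thesis using IH False by (simp add: U_def)
  qed
qed simp

lemma exec_time_eq_measure: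
  assumes "well_formed ps" "preemptive_feasible m I (schedule_of ps)"
  shows "exec_time k ps = measure lborel (busy m (schedule_of ps) k)"
proof -
  have "exec_time k ps
      = (\<Sum>p\<leftarrow>ps. if pjob p = k then measure lborel ({start p..<finish p} \<inter> UNIV) else 0)"
    using assms(1) by (induction ps) (auto simp: well_formed_def)
  then show ?thesis
    using sum_measure_pieces[OF assms(1), of UNIV k] busy_schedule_of[OF assms] by simp
qed

lemma exec_before_eq_measure:
  assumes "well_formed ps" "preemptive_feasible m I (schedule_of ps)"
  shows "exec_before T k ps = measure lborel (busy m (schedule_of ps) k \<inter> {..<T})"
proof -
  have *: "measure lborel ({a..<b} \<inter> {..<T}) = max 0 (min b T - a)" if "a < b" for a b :: real
  proof -
    have "{a..<b} \<inter> {..<T} = {a..<min b T}" by auto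
    then show ?thesis by (cases "a \<le> min b T") auto
  qed
  have "exec_before T k ps
      = (\<Sum>p\<leftarrow>ps. if pjob p = k then measure lborel ({start p..<finish p} \<inter> {..<T}) else 0)"
    using assms(1) by (induction ps) (auto simp: well_formed_def *)
  then show ?thesis
    using sum_measure_pieces[OF assms(1), of "{..<T}" k] busy_schedule_of[OF assms] by simp
qed

lemma exec_after_eq_measure:
  assumes "well_formed ps" "preemptive_feasible m I (schedule_of ps)"
  shows "exec_after T k ps = measure lborel (busy m (schedule_of ps) k \<inter> {T..})"
proof -
  have *: "measure lborel ({a..<b} \<inter> {T..}) = max 0 (b - max a T)" if "a < b" for a b :: real
  proof -
    have "{a..<b} \<inter> {T..} = {max a T..<b}" by auto
    then show ?thesis by (cases "max a T \<le> b") auto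
  qed
  have "exec_after T k ps
      = (\<Sum>p\<leftarrow>ps. if pjob p = k then measure lborel ({start p..<finish p} \<inter> {T..}) else 0)"
    using assms(1) by (induction ps) (auto simp: well_formed_def *)
  then show ?thesis
    using sum_measure_pieces[OF assms(1), of "{T..}" k] busy_schedule_of[OF assms] by simp
qed

section \<open>Energy of preemptive schedules\<close>

text \<open>At most one job has positive speed on a processor at a time, so the power of the sum of
  speeds is the sum of the powers. This lets all later energy estimates be made job by job.\<close>

lemma energy_eq_sum_job_energy:
  assumes "valid_instance I" "preemptive_feasible m I S"
  shows "energy \<alpha> m I S = (\<Sum>j\<in>set I. job_energy \<alpha> m S (jid j))"
proof -
  have pointwise: "ennreal ((\<Sum>j\<in>set I. S (jid j) i t) powr \<alpha>)
      = (\<Sum>j\<in>set I. ennreal (S (jid j) i t powr \<alpha>))" for i t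
  proof (cases "\<exists>j\<in>set I. 0 < S (jid j) i t")
    case True
    then obtain j where j: "j \<in> set I" "0 < S (jid j) i t" by blast
    have zero: "S (jid j') i t = 0" if "j' \<in> set I" "j' \<noteq> j" for j'
    proof (rule ccontr)
      assume "S (jid j') i t \<noteq> 0"
      then have "0 < S (jid j') i t" using preemptive_feasibleD(2)[OF assms(2), of "jid j'" i t] by simp
      then have "jid j' = jid j" using j preemptive_feasibleD(5)[OF assms(2)] by blast
      then show False using that j valid_instanceD(3)[OF assms(1)] by blast
    qed
    have "(\<Sum>j\<in>set I. S (jid j) i t) = S (jid j) i t"
      using j(1) zero by (subst sum.remove[of _ j]) auto
    moreover have "(\<Sum>j\<in>set I. ennreal (S (jid j) i t powr \<alpha>)) = ennreal (S (jid j) i t powr \<alpha>)"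
      using j(1) zero by (subst sum.remove[of _ j]) auto
    ultimately show ?thesis by simp
  next
    case False
    then have "S (jid j) i t = 0" if "j \<in> set I" for j
      using that preemptive_feasibleD(2)[OF assms(2), of "jid j" i t] by force
    then show ?thesis by simp
  qed
  have [measurable]: "S k i \<in> borel_measurable borel" for k i
    using preemptive_feasibleD(1)[OF assms(2)] .
  show ?thesis
    unfolding energy_def job_energy_def pointwise
    by (subst nn_integral_sum) (auto intro: sum.swap)
qed

text \<open>The graph of the convex function \<open>s powr \<alpha>\<close> lies above its tangent
  at \<open>c\<close>. Arranged without subtraction, the inequality can be integrated in the
  extended nonnegative reals. It is Young's inequality for the exponents \<open>\<alpha>\<close> and
  \<open>\<alpha> / (\<alpha> - 1)\<close>.\<close>

lemma powr_tangent_le: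
  assumes "1 < \<alpha>" "0 \<le> s" "0 < (c::real)"
  shows "\<alpha> * c powr (\<alpha> - 1) * s \<le> s powr \<alpha> + (\<alpha> - 1) * c powr \<alpha>"
proof -
  have "s * c powr (\<alpha> - 1)
      \<le> s powr \<alpha> / \<alpha> + (c powr (\<alpha> - 1)) powr (\<alpha> / (\<alpha> - 1)) / (\<alpha> / (\<alpha> - 1))"
    using assms by (intro Youngs_inequality) (auto simp: field_simps)
  moreover have "(c powr (\<alpha> - 1)) powr (\<alpha> / (\<alpha> - 1)) = c powr \<alpha>"
    using assms by (simp add: powr_powr)
  ultimately have "\<alpha> * (s * c powr (\<alpha> - 1)) \<le> \<alpha> * (s powr \<alpha> / \<alpha> + c powr \<alpha> / (\<alpha> / (\<alpha> - 1)))"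
    using assms by (intro mult_left_mono) auto
  also have "\<dots> = s powr \<alpha> + (\<alpha> - 1) * c powr \<alpha>"
    using assms by (simp add: field_simps)
  finally show ?thesis by (simp add: algebra_simps)
qed

lemma emeasure_active_Int:
  assumes "valid_instance I" "preemptive_feasible m I S" "j \<in> set I"
  shows "emeasure lborel (active S (jid j) i \<inter> B) = ennreal (measure lborel (active S (jid j) i \<inter> B))"
proof -
  have "emeasure lborel (active S (jid j) i \<inter> B) < \<infinity>"
    using bounded_subset[OF bounded_closed_interval active_subset_window[OF assms, of i]]
    by (intro emeasure_bounded_finite) (simp add: bounded_Int)
  then show ?thesis by (simp add: emeasure_eq_ennreal_measure)
qed

text \<open>A null set of running times would make the speed vanish almost everywhere, so no work
  would be done. Positivity allows division by execution times.\<close>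

lemma measure_busy_pos:
  assumes "valid_instance I" "preemptive_feasible m I S" "j \<in> set I"
  shows "0 < measure lborel (busy m S (jid j))"
proof (rule ccontr)
  assume "\<not> ?thesis"
  then have "measure lborel (busy m S (jid j)) = 0"
    using measure_nonneg[of lborel "busy m S (jid j)"] by linarith
  then have "(\<Sum>i<m. measure lborel (active S (jid j) i)) = 0"
    by (simp add: measure_busy[OF assms])
  then have zero: "measure lborel (active S (jid j) i) = 0" if "i < m" for i
    using that by (subst (asm) sum_nonneg_eq_0_iff) auto
  have "(\<integral>\<^sup>+t. ennreal (S (jid j) i t) \<partial>lborel) = 0" if "i < m" for i
  proof -
    have [measurable]: "S (jid j) i \<in> borel_measurable borel"
      using preemptive_feasibleD(1)[OF assms(2)] .
    have "emeasure lborel {t. 0 < S (jid j) i t} = 0"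
      using emeasure_active_Int[OF assms, of i UNIV] zero[OF that] by (simp add: active_def)
    then have "AE t in lborel. \<not> 0 < S (jid j) i t"
      by (intro AE_I[where N = "{t. 0 < S (jid j) i t}"]) auto
    then have "AE t in lborel. ennreal (S (jid j) i t) = 0"
      by eventually_elim (simp add: ennreal_neg)
    then show ?thesis by (subst nn_integral_0_iff_AE) auto
  qed
  then have "ennreal (work j) = 0"
    using preemptive_feasibleD(7)[OF assms(2,3)] by simp
  then show False using valid_instanceD(1)[OF assms(1,3)] by simp
qed

text \<open>Integrate the tangent inequality at the average speed over the times at which the job runs.\<close>

lemma job_energy_ge:
  assumes "1 < \<alpha>" "valid_instance I" "preemptive_feasible m I S" "j \<in> set I"
  defines "e \<equiv> measure lborel (busy m S (jid j))"
  shows "ennreal (work j * (work j / e) powr (\<alpha> - 1)) \<le> job_energy \<alpha> m S (jid j)"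
proof (cases "job_energy \<alpha> m S (jid j)")
  \<comment> \<open>Infinite energy satisfies the bound trivially, so only a real value
    \<open>x\<close> remains. Below, \<open>c\<close> is the average speed of the job.\<close>
  case (real x)
  define c where "c = work j / e"
  have e: "0 < e" unfolding e_def using measure_busy_pos[OF assms(2-4)] .
  have w: "0 < work j" using valid_instanceD(1)[OF assms(2,4)] .
  then have c: "0 < c" using e by (simp add: c_def)
  have [measurable]: "S (jid j) i \<in> borel_measurable borel" for i
    using preemptive_feasibleD(1)[OF assms(3)] .
  have [measurable]: "active S (jid j) i \<in> sets borel" for i
    using active_measurable[OF assms(3)] .
  have int: "ennreal (\<alpha> * c powr (\<alpha> - 1)) * (\<integral>\<^sup>+t. ennreal (S (jid j) i t) \<partial>lborel)
      \<le> (\<integral>\<^sup>+t. ennreal (S (jid j) i t powr \<alpha>) \<partial>lborel)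
        + ennreal ((\<alpha> - 1) * c powr \<alpha>) * ennreal (measure lborel (active S (jid j) i))" for i
  proof -
    \<comment> \<open>While the job is idle the left side is 0, so the indicator may restrict the
      constant term to the running times; these integrate to the execution time.\<close>
    have "ennreal (\<alpha> * c powr (\<alpha> - 1)) * ennreal (S (jid j) i t)
        \<le> ennreal (S (jid j) i t powr \<alpha>)
          + ennreal ((\<alpha> - 1) * c powr \<alpha>) * indicator (active S (jid j) i) t" for t
    proof (cases "0 < S (jid j) i t")
      case True
      have "ennreal (\<alpha> * c powr (\<alpha> - 1)) * ennreal (S (jid j) i t)
          = ennreal (\<alpha> * c powr (\<alpha> - 1) * S (jid j) i t)"
        using True assms(1) by (intro ennreal_mult[symmetric]) auto
      also have "\<dots> \<le> ennreal (S (jid j) i t powr \<alpha> + (\<alpha> - 1) * c powr \<alpha>)"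
        using powr_tangent_le[OF assms(1) _ c, of "S (jid j) i t"] True by (intro ennreal_leI) simp
      also have "\<dots> = ennreal (S (jid j) i t powr \<alpha>) + ennreal ((\<alpha> - 1) * c powr \<alpha>)"
        using assms(1) by (intro ennreal_plus) auto
      finally show ?thesis using True by (simp add: active_def)
    qed (simp add: ennreal_neg)
    then have "(\<integral>\<^sup>+t. ennreal (\<alpha> * c powr (\<alpha> - 1)) * ennreal (S (jid j) i t) \<partial>lborel)
        \<le> (\<integral>\<^sup>+t. ennreal (S (jid j) i t powr \<alpha>)
          + ennreal ((\<alpha> - 1) * c powr \<alpha>) * indicator (active S (jid j) i) t \<partial>lborel)"
      by (intro nn_integral_mono)
    then show ?thesis
      using emeasure_active_Int[OF assms(2-4), of i UNIV]
      by (simp add: nn_integral_cmult nn_integral_add nn_integral_cmult_indicator)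
  qed
  have "ennreal (\<alpha> * c powr (\<alpha> - 1)) * ennreal (work j)
      = (\<Sum>i<m. ennreal (\<alpha> * c powr (\<alpha> - 1)) * (\<integral>\<^sup>+t. ennreal (S (jid j) i t) \<partial>lborel))"
    by (simp only: preemptive_feasibleD(7)[OF assms(3,4), symmetric] sum_distrib_left)
  also have "\<dots> \<le> (\<Sum>i<m. (\<integral>\<^sup>+t. ennreal (S (jid j) i t powr \<alpha>) \<partial>lborel)
        + ennreal ((\<alpha> - 1) * c powr \<alpha>) * ennreal (measure lborel (active S (jid j) i)))"
    using int by (intro sum_mono)
  also have "\<dots> = job_energy \<alpha> m S (jid j) + ennreal ((\<alpha> - 1) * c powr \<alpha>) * ennreal e"
    unfolding e_def measure_busy[OF assms(2-4)] job_energy_def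
    by (simp add: sum.distrib sum_distrib_left[symmetric] sum_ennreal)
  also have "\<dots> = ennreal (x + (\<alpha> - 1) * c powr \<alpha> * e)"
    using real e assms(1) by (simp add: ennreal_mult[symmetric])
  finally have "ennreal (\<alpha> * c powr (\<alpha> - 1) * work j) \<le> ennreal (x + (\<alpha> - 1) * c powr \<alpha> * e)"
    using assms(1) w by (simp add: ennreal_mult)
  then have "\<alpha> * c powr (\<alpha> - 1) * work j \<le> x + (\<alpha> - 1) * c powr \<alpha> * e"
    using assms(1) real e by (subst (asm) ennreal_le_iff) auto
  \<comment> \<open>Since \<open>c * e\<close> is the work, the terms with coefficients
    \<open>\<alpha>\<close> and \<open>\<alpha> - 1\<close> cancel up to a single copy of
    \<open>work j * c powr (\<alpha> - 1)\<close>.\<close>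
  moreover have "c powr \<alpha> * e = c powr (\<alpha> - 1) * work j"
    using c e by (simp add: powr_diff c_def field_simps)
  ultimately have "work j * c powr (\<alpha> - 1) \<le> x"
    by (simp add: algebra_simps)
  then show ?thesis unfolding real c_def[symmetric] using real by (simp add: ennreal_leI)
qed simp

text \<open>The new schedule runs each job at its old running times inside \<open>B\<close>, at the
  constant speed that completes its work. At least half of the execution time lies in
  \<open>B\<close>, so this speed is at most twice the old average, which costs a factor of at most
  \<open>2 powr (\<alpha> - 1)\<close>.\<close>

lemma exists_squeezed_schedule:
  assumes "1 < \<alpha>" "valid_instance I" "preemptive_feasible m I S"
    and I': "valid_instance I'" and B: "B \<in> sets borel"
    and I'I: "\<And>j'. j' \<in> set I' \<Longrightarrow> \<exists>j\<in>set I. jid j = jid j' \<and> work j = work j' \<and>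
       {release j..deadline j} \<inter> B \<subseteq> {release j'..deadline j'} \<and>
       measure lborel (busy m S (jid j)) \<le> 2 * measure lborel (busy m S (jid j) \<inter> B)"
  shows "\<exists>S'. preemptive_feasible m I' S' \<and>
    energy \<alpha> m I' S' \<le> ennreal (2 powr (\<alpha> - 1)) * (\<Sum>j\<in>set I'. job_energy \<alpha> m S (jid j))"
proof -
  define e where "e k = measure lborel (busy m S k \<inter> B)" for k
  \<comment> \<open>Schedules are indexed by identifiers, so the speed has to recover the job from
    its identifier.\<close>
  define c where "c k = work (the_inv_into (set I') jid k) / e k" for k
  define S' where "S' k i t = (if k \<in> jid ` set I' \<and> t \<in> active S k i \<inter> B then c k else 0)" for k i t
  have c: "c (jid j) = work j / e (jid j)" if "j \<in> set I'" for j
    using the_inv_into_f_f[OF valid_instanceD(5)[OF I'] that] by (simp add: c_def)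
  have e: "0 < e (jid j)" "measure lborel (busy m S (jid j)) \<le> 2 * e (jid j)" if j: "j \<in> set I'" for j
  proof -
    obtain j0 where "j0 \<in> set I" "jid j0 = jid j"
      and le: "measure lborel (busy m S (jid j0)) \<le> 2 * measure lborel (busy m S (jid j0) \<inter> B)"
      using I'I[OF j] by blast
    then show "0 < e (jid j)" "measure lborel (busy m S (jid j)) \<le> 2 * e (jid j)"
      using measure_busy_pos[OF assms(2,3), of j0] by (auto simp: e_def)
  qed
  have w: "0 < work j" if "j \<in> set I'" for j using valid_instanceD(1)[OF I' that] .
  have cpos: "0 < c (jid j)" if "j \<in> set I'" for j
    using e w that by (simp add: c)
  have act[measurable]: "active S k i \<in> sets borel" for k i
    using active_measurable[OF assms(3)] .
  have pos: "0 < S' k i t \<longleftrightarrow> k \<in> jid ` set I' \<and> t \<in> active S k i \<inter> B" for k i t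
    using cpos by (auto simp: S'_def)
  \<comment> \<open>A general \<open>f\<close> covers both the processed work (identity) and the
    energy (\<open>\<alpha>\<close>-th power).\<close>
  have integral: "(\<Sum>i<m. \<integral>\<^sup>+t. ennreal (f (S' (jid j) i t)) \<partial>lborel) = ennreal (f (c (jid j)) * e (jid j))"
    if j: "j \<in> set I'" and f: "f 0 = 0" "0 \<le> f (c (jid j))" for j and f :: "real \<Rightarrow> real"
  proof -
    obtain j0 where j0: "j0 \<in> set I" "jid j0 = jid j" using I'I[OF j] by blast
    have "ennreal (f (S' (jid j) i t)) = ennreal (f (c (jid j))) * indicator (active S (jid j) i \<inter> B) t" for i t
      using j f by (auto simp: S'_def indicator_def)
    then have "(\<Sum>i<m. \<integral>\<^sup>+t. ennreal (f (S' (jid j) i t)) \<partial>lborel)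
        = (\<Sum>i<m. ennreal (f (c (jid j))) * ennreal (measure lborel (active S (jid j) i \<inter> B)))"
      using B emeasure_active_Int[OF assms(2,3) j0(1)] j0(2) by (simp add: nn_integral_cmult_indicator)
    also have "\<dots> = ennreal (f (c (jid j))) * ennreal (e (jid j))"
      using measure_busy_Int[OF assms(2,3) j0(1) B] j0(2)
      by (simp add: sum_distrib_left[symmetric] sum_ennreal e_def)
    finally show ?thesis using f(2) by (simp add: ennreal_mult e_def)
  qed
  have feasible: "preemptive_feasible m I' S'"
    unfolding preemptive_feasible_def
  proof (intro conjI allI impI ballI)
    show "S' k i \<in> borel_measurable borel" for k i
      unfolding S'_def using B by (cases "k \<in> jid ` set I'") (auto intro!: measurable_If)
    show "0 \<le> S' k i t" for k i t
      using cpos by (auto simp: S'_def less_imp_le)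
    show "i < m" if "0 < S' k i t" for k i t
      using that preemptive_feasibleD(3)[OF assms(3)] by (auto simp: pos active_def)
    show "k = k'" if "0 < S' k i t" "0 < S' k' i t" for k k' i t
      using that preemptive_feasibleD(5)[OF assms(3)] by (auto simp: pos active_def)
    show "i = i'" if "0 < S' k i t" "0 < S' k i' t" for k i i' t
      using that preemptive_feasibleD(6)[OF assms(3)] by (auto simp: pos active_def)
    show "\<exists>j\<in>set I'. jid j = k \<and> release j \<le> t \<and> t \<le> deadline j" if S'pos: "0 < S' k i t" for k i t
    proof -
      obtain j where j: "j \<in> set I'" "jid j = k" "t \<in> active S k i" "t \<in> B"
        using S'pos by (auto simp: pos)
      then obtain j0 where "j0 \<in> set I" "jid j0 = jid j"
        "{release j0..deadline j0} \<inter> B \<subseteq> {release j..deadline j}"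
        using I'I by blast
      then have "t \<in> {release j..deadline j}"
        using active_subset_window[OF assms(2,3), of j0 i] j by auto
      then show ?thesis using j by auto
    qed
    show "(\<Sum>i<m. \<integral>\<^sup>+t. ennreal (S' (jid j) i t) \<partial>lborel) = ennreal (work j)" if "j \<in> set I'" for j
      using integral[OF that, of "\<lambda>x. x"] cpos[OF that] e[OF that] c[OF that] by simp
  qed
  have "job_energy \<alpha> m S' (jid j) \<le> ennreal (2 powr (\<alpha> - 1)) * job_energy \<alpha> m S (jid j)"
    if j: "j \<in> set I'" for j
  proof -
    obtain j0 where j0: "j0 \<in> set I" "jid j0 = jid j" "work j0 = work j"
      using I'I[OF j] by blast
    define b where "b = measure lborel (busy m S (jid j))"
    have b: "0 < b" using measure_busy_pos[OF assms(2,3) j0(1)] j0(2) by (simp add: b_def)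
    have ee: "0 < e (jid j)" "b \<le> 2 * e (jid j)" using e[OF j] by (simp_all add: b_def)
    have "c (jid j) powr \<alpha> * e (jid j) = work j * c (jid j) powr (\<alpha> - 1)"
      using cpos[OF j] ee by (simp add: powr_diff c[OF j] field_simps)
    \<comment> \<open>Here \<open>b \<le> 2 * e (jid j)\<close> bounds the constant speed by twice
      the average speed \<open>work j / b\<close>.\<close>
    also have "\<dots> \<le> work j * (2 * (work j / b)) powr (\<alpha> - 1)"
      using assms(1) w[OF j] ee b cpos[OF j]
      by (intro mult_left_mono powr_mono2) (auto simp: c[OF j] field_simps)
    also have "\<dots> = 2 powr (\<alpha> - 1) * (work j * (work j / b) powr (\<alpha> - 1))"
      using w[OF j] b by (simp add: powr_mult powr_divide)
    finally have "job_energy \<alpha> m S' (jid j)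
        \<le> ennreal (2 powr (\<alpha> - 1) * (work j * (work j / b) powr (\<alpha> - 1)))"
      using integral[OF j, of "\<lambda>x. x powr \<alpha>"] by (simp add: job_energy_def ennreal_leI)
    also have "\<dots> = ennreal (2 powr (\<alpha> - 1)) * ennreal (work j * (work j / b) powr (\<alpha> - 1))"
      using w[OF j] by (intro ennreal_mult) auto
    also have "\<dots> \<le> ennreal (2 powr (\<alpha> - 1)) * job_energy \<alpha> m S (jid j)"
      using job_energy_ge[OF assms(1-3) j0(1)] j0 by (intro mult_left_mono) (auto simp: b_def)
    finally show ?thesis .
  qed
  then have "energy \<alpha> m I' S' \<le> ennreal (2 powr (\<alpha> - 1)) * (\<Sum>j\<in>set I'. job_energy \<alpha> m S (jid j))"
    unfolding energy_eq_sum_job_energy[OF I' feasible] sum_distrib_left by (intro sum_mono)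
  with feasible show ?thesis by blast
qed

section \<open>Non-preemptive schedules given by pieces\<close>

definition cost :: "real \<Rightarrow> piece list \<Rightarrow> real" where
  "cost \<alpha> ps = (\<Sum>p\<leftarrow>ps. (finish p - start p) * pspeed p powr \<alpha>)"

text \<open>A finite certificate for non-preemptive feasibility that speaks only about list entries.
  The outputs of the algorithms are checked against it, and the passage to measurable speed
  functions is made once, for all of them.\<close>

definition nonpreemptive_pieces :: "nat \<Rightarrow> job list \<Rightarrow> piece list \<Rightarrow> bool" where
  "nonpreemptive_pieces m I ps \<longleftrightarrow>
     distinct (map pjob ps) \<and> pjob ` set ps = jid ` set I \<and>
     (\<forall>p\<in>set ps. \<forall>j\<in>set I. pjob p = jid j \<longrightarrow>
        proc p < m \<and> start p < finish p \<and> release j \<le> start p \<and> finish p \<le> deadline j \<and>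
        pspeed p = work j / (finish p - start p)) \<and>
     (\<forall>p\<in>set ps. \<forall>q\<in>set ps. proc p = proc q \<longrightarrow>
        p = q \<or> finish p \<le> start q \<or> finish q \<le> start p)"

lemma schedule_of_distinct:
  assumes "distinct (map pjob ps)" "p \<in> set ps"
  shows "schedule_of ps (pjob p) i t
    = (if proc p = i \<and> start p \<le> t \<and> t < finish p then pspeed p else 0)"
proof -
  let ?f = "\<lambda>q. if pjob q = pjob p \<and> proc q = i \<and> start q \<le> t \<and> t < finish q then pspeed q else 0"
  have "schedule_of ps (pjob p) i t = (\<Sum>q\<in>set ps. ?f q)"
    using assms(1) unfolding schedule_of_def
    by (intro sum_list_distinct_conv_sum_set) (simp add: distinct_map)
  also have "\<dots> = ?f p + (\<Sum>q\<in>set ps - {p}. ?f q)"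
    using assms(2) by (intro sum.remove) auto
  also have "(\<Sum>q\<in>set ps - {p}. ?f q) = 0"
    using assms by (intro sum.neutral) (auto simp: distinct_map inj_on_def)
  finally show ?thesis by simp
qed

lemma schedule_of_notin:
  assumes "k \<notin> pjob ` set ps"
  shows "schedule_of ps k i t = 0"
  using assms unfolding schedule_of_def by (induction ps) auto

context
  fixes m I ps
  assumes valid: "valid_instance I" and np: "nonpreemptive_pieces m I ps"
begin

lemma nonpreemptive_pieces_job:
  assumes "p \<in> set ps"
  shows "\<exists>j\<in>set I. jid j = pjob p \<and> proc p < m \<and> start p < finish p \<and> release j \<le> start p \<and>
    finish p \<le> deadline j \<and> pspeed p = work j / (finish p - start p) \<and> 0 < pspeed p"
proof -
  have "pjob p \<in> jid ` set I" using np assms unfolding nonpreemptive_pieces_def by blast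
  then obtain j where j: "j \<in> set I" "pjob p = jid j" by blast
  then show ?thesis
    using np assms valid_instanceD(1)[OF valid, of j]
    by (intro bexI[of _ j]) (auto simp: nonpreemptive_pieces_def)
qed

lemma nonpreemptive_pieces_schedule:
  assumes "p \<in> set ps"
  shows "schedule_of ps (pjob p) i t
    = (if proc p = i \<and> start p \<le> t \<and> t < finish p then pspeed p else 0)"
  using schedule_of_distinct assms np unfolding nonpreemptive_pieces_def by blast

lemma nonpreemptive_pieces_pos:
  "0 < schedule_of ps k i t \<longleftrightarrow>
    (\<exists>p\<in>set ps. pjob p = k \<and> proc p = i \<and> start p \<le> t \<and> t < finish p)"
  using nonpreemptive_pieces_job by (intro schedule_of_pos_iff) blast

text \<open>As \<open>f\<close> vanishes at 0, only the piece itself contributes. The identity gives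
  the processed work of the job, the \<open>\<alpha>\<close>-th power its energy.\<close>

lemma nonpreemptive_pieces_integral:
  assumes p: "p \<in> set ps" and f: "f 0 = 0" "0 \<le> f (pspeed p)"
  shows "(\<Sum>i<m. \<integral>\<^sup>+t. ennreal (f (schedule_of ps (pjob p) i t)) \<partial>lborel)
    = ennreal ((finish p - start p) * f (pspeed p))"
proof -
  have pm: "proc p < m" "start p < finish p" using nonpreemptive_pieces_job[OF p] by auto
  have "ennreal (f (schedule_of ps (pjob p) i t))
      = (if i = proc p then ennreal (f (pspeed p)) else 0) * indicator {start p..<finish p} t" for i t
    using f by (auto simp: nonpreemptive_pieces_schedule[OF p] indicator_def)
  then have "(\<integral>\<^sup>+t. ennreal (f (schedule_of ps (pjob p) i t)) \<partial>lborel)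
      = (if i = proc p then ennreal (f (pspeed p)) * ennreal (finish p - start p) else 0)" for i
    using pm by (simp add: nn_integral_cmult_indicator)
  then have "(\<Sum>i<m. \<integral>\<^sup>+t. ennreal (f (schedule_of ps (pjob p) i t)) \<partial>lborel)
      = ennreal (f (pspeed p)) * ennreal (finish p - start p)"
    using pm by simp
  then show ?thesis using f(2) pm by (simp add: ennreal_mult[symmetric] mult.commute)
qed

lemma nonpreemptive_pieces_of_job:
  assumes "j \<in> set I"
  obtains p where "p \<in> set ps" "pjob p = jid j" "pspeed p = work j / (finish p - start p)"
    "start p < finish p"
proof -
  have "jid j \<in> pjob ` set ps" using np assms unfolding nonpreemptive_pieces_def by blast
  then obtain p where p: "p \<in> set ps" "pjob p = jid j" by auto
  then show ?thesis using np assms by (intro that[of p]) (auto simp: nonpreemptive_pieces_def)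
qed

lemma nonpreemptive_pieces_well_formed: "well_formed ps"
  unfolding well_formed_def
proof (intro conjI ballI)
  \<comment> \<open>With one piece per job, different entries never share a job and the condition is
    vacuous.\<close>
  have "distinct (map pjob ps)" using np unfolding nonpreemptive_pieces_def by blast
  then show "sorted_wrt (\<lambda>p q. pjob p = pjob q \<longrightarrow> finish p \<le> start q \<or> finish q \<le> start p) ps"
    by (induction ps) force+
qed (use nonpreemptive_pieces_job in blast)+

lemma nonpreemptive_pieces_preemptive_feasible:
  "preemptive_feasible m I (schedule_of ps)"
  unfolding preemptive_feasible_def
proof (intro conjI allI impI ballI)
  show "schedule_of ps k i \<in> borel_measurable borel" for k i
  proof (cases "k \<in> pjob ` set ps")
    case True
    then obtain p where p: "p \<in> set ps" "k = pjob p" by blast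
    have "schedule_of ps k i
        = (\<lambda>t. if proc p = i \<and> start p \<le> t \<and> t < finish p then pspeed p else 0)"
      unfolding p(2) using nonpreemptive_pieces_schedule[OF p(1)] by blast
    then show ?thesis by simp
  next
    case False
    then have "schedule_of ps k i = (\<lambda>t. 0)" using schedule_of_notin by blast
    then show ?thesis by simp
  qed
  show "0 \<le> schedule_of ps k i t" for k i t
  proof (cases "k \<in> pjob ` set ps")
    case True
    then obtain p where p: "p \<in> set ps" "k = pjob p" by blast
    then show ?thesis
      using nonpreemptive_pieces_job[OF p(1)] by (auto simp: nonpreemptive_pieces_schedule)
  qed (simp add: schedule_of_notin)
  show "i < m" if "0 < schedule_of ps k i t" for k i t
    using that nonpreemptive_pieces_job by (auto simp: nonpreemptive_pieces_pos)
  show "\<exists>j\<in>set I. jid j = k \<and> release j \<le> t \<and> t \<le> deadline j" if "0 < schedule_of ps k i t" for k i t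
  proof -
    obtain p where p: "p \<in> set ps" "pjob p = k" "start p \<le> t" "t < finish p"
      using \<open>0 < schedule_of ps k i t\<close> by (auto simp: nonpreemptive_pieces_pos)
    then show ?thesis using nonpreemptive_pieces_job[OF p(1)] by force
  qed
  show "k = k'" if "0 < schedule_of ps k i t" "0 < schedule_of ps k' i t" for k k' i t
  proof -
    obtain p q where pq: "p \<in> set ps" "q \<in> set ps" "pjob p = k" "pjob q = k'" "proc p = proc q"
      "start p \<le> t" "t < finish p" "start q \<le> t" "t < finish q"
      using \<open>0 < schedule_of ps k i t\<close> \<open>0 < schedule_of ps k' i t\<close>
      by (auto simp: nonpreemptive_pieces_pos)
    have "p = q \<or> finish p \<le> start q \<or> finish q \<le> start p"
      using np pq(1,2,5) unfolding nonpreemptive_pieces_def by blast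
    then show ?thesis using pq by auto
  qed
  show "i = i'" if "0 < schedule_of ps k i t" "0 < schedule_of ps k i' t" for k i i' t
  proof -
    have "k \<in> pjob ` set ps" using that(1) by (auto simp: nonpreemptive_pieces_pos)
    then obtain p where p: "p \<in> set ps" "k = pjob p" by blast
    then show ?thesis using that by (auto simp: nonpreemptive_pieces_schedule split: if_splits)
  qed
  show "(\<Sum>i<m. \<integral>\<^sup>+t. ennreal (schedule_of ps (jid j) i t) \<partial>lborel) = ennreal (work j)"
    if j: "j \<in> set I" for j
  proof -
    obtain p where p: "p \<in> set ps" "pjob p = jid j" "pspeed p = work j / (finish p - start p)"
      "start p < finish p" using nonpreemptive_pieces_of_job[OF j] .
    have "0 < pspeed p" using nonpreemptive_pieces_job[OF p(1)] by blast
    then show ?thesis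
      using nonpreemptive_pieces_integral[OF p(1), of "\<lambda>x. x"] p by simp
  qed
qed

lemma nonpreemptive_pieces_feasible:
  "nonpreemptive_feasible m I (schedule_of ps)"
  unfolding nonpreemptive_feasible_def
proof (intro conjI ballI nonpreemptive_pieces_preemptive_feasible)
  fix j assume j: "j \<in> set I"
  obtain p where p: "p \<in> set ps" "pjob p = jid j" using nonpreemptive_pieces_of_job[OF j] .
  have "proc p < m" "0 < pspeed p" using nonpreemptive_pieces_job[OF p(1)] by auto
  moreover have "{t. 0 < schedule_of ps (jid j) (proc p) t} = {start p..<finish p}"
    using \<open>0 < pspeed p\<close> nonpreemptive_pieces_schedule[OF p(1)] p(2) by auto
  moreover have "\<forall>i'. i' \<noteq> proc p \<longrightarrow> (\<forall>t. schedule_of ps (jid j) i' t = 0)"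
    using nonpreemptive_pieces_schedule[OF p(1)] p(2) by auto
  moreover have "is_interval {start p..<finish p}" by (simp add: is_interval_co)
  ultimately show "\<exists>i<m. is_interval {t. 0 < schedule_of ps (jid j) i t} \<and>
      (\<forall>i'. i' \<noteq> i \<longrightarrow> (\<forall>t. schedule_of ps (jid j) i' t = 0))"
    by (intro exI[of _ "proc p"]) simp
qed

lemma nonpreemptive_pieces_energy:
  "energy \<alpha> m I (schedule_of ps) = ennreal (cost \<alpha> ps)" if "1 < \<alpha>"
proof -
  have dist: "distinct (map pjob ps)" and image: "pjob ` set ps = jid ` set I"
    using np unfolding nonpreemptive_pieces_def by blast+
  have "energy \<alpha> m I (schedule_of ps) = (\<Sum>k\<in>jid ` set I. job_energy \<alpha> m (schedule_of ps) k)"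
    using valid_instanceD(5)[OF valid]
    by (simp add: energy_eq_sum_job_energy[OF valid nonpreemptive_pieces_preemptive_feasible]
        sum.reindex)
  also have "\<dots> = (\<Sum>p\<in>set ps. job_energy \<alpha> m (schedule_of ps) (pjob p))"
    using dist by (simp add: image[symmetric] sum.reindex distinct_map)
  also have "\<dots> = (\<Sum>p\<in>set ps. ennreal ((finish p - start p) * pspeed p powr \<alpha>))"
    using nonpreemptive_pieces_integral[of _ "\<lambda>x. x powr \<alpha>"]
    by (intro sum.cong) (auto simp: job_energy_def)
  also have "\<dots> = ennreal (\<Sum>p\<in>set ps. (finish p - start p) * pspeed p powr \<alpha>)"
    using nonpreemptive_pieces_job by (intro sum_ennreal) (force intro!: mult_nonneg_nonneg)
  also have "(\<Sum>p\<in>set ps. (finish p - start p) * pspeed p powr \<alpha>) = cost \<alpha> ps"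
    using dist unfolding cost_def by (simp add: sum_list_distinct_conv_sum_set distinct_map)
  finally show ?thesis .
qed

end

section \<open>List scheduling\<close>

text \<open>The part of a piece that does not depend on where it is placed. It determines the cost
  and survives time reversal.\<close>

definition piece_data :: "piece \<Rightarrow> nat \<times> real \<times> real" where
  "piece_data p = (pjob p, finish p - start p, pspeed p)"

lemma insort_key_not_Nil: "insort_key f x xs \<noteq> []"
  by (cases xs) auto

lemma map_insort_key:
  "map h (insort_key (\<lambda>x. f (h x)) x xs) = insort_key f (h x) (map h xs)"
  by (induction xs) auto

lemma map_sort_key: "map h (sort_key (\<lambda>x. f (h x)) xs) = sort_key f (map h xs)"
  by (induction xs) (simp_all add: map_insort_key)

lemma processors_props:
  shows "length (processors t n) = n"
    and "map fst (processors t n) = replicate n t"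
    and "distinct (map snd (processors t n))"
    and "set (processors t n) = (\<lambda>i. (t, i)) ` {..<n}"
proof -
  show set: "set (processors t n) = (\<lambda>i. (t, i)) ` {..<n}" for n
    by (induction n) (auto simp: lessThan_Suc)
  show "distinct (map snd (processors t n))"
    by (induction n) (auto simp: set)
qed (induction n; simp)+

text \<open>\<open>forward\<close> drops the remaining jobs when the queue is empty. Reinsertion
  keeps the length of the queue, so this happens only if it is empty from the start.\<close>

lemma piece_data_forward:
  "q \<noteq> [] \<or> xs = [] \<Longrightarrow>
    map piece_data (forward q xs) = map (\<lambda>(j, p). (jid j, p, work j / p)) xs"
  by (induction q xs rule: forward.induct) (auto simp: piece_data_def insort_key_not_Nil)

lemma length_forward_le: "length (forward q xs) \<le> length xs"
  by (induction q xs rule: forward.induct) auto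

text \<open>Durations are positive, so the free time of a processor only increases and its initial
  entry bounds all its later starts.\<close>

lemma forward_from_queue:
  assumes "\<forall>x\<in>set xs. 0 < snd x" "p \<in> set (forward q xs)"
  shows "\<exists>t. (t, proc p) \<in> set q \<and> t \<le> start p"
  using assms
proof (induction q xs rule: forward.induct)
  case (3 t i q j d xs)
  show ?case
  proof (cases "p \<in> set (forward (insort_key (\<lambda>(t, i). t) (t + d, i) q) xs)")
    case True
    then obtain s where "(s, proc p) \<in> set (insort_key (\<lambda>(t, i). t) (t + d, i) q)" "s \<le> start p"
      using 3 by auto
    then have "(s, proc p) = (t + d, i) \<or> (s, proc p) \<in> set q" by (auto simp: set_insort_key)
    then show ?thesis using \<open>s \<le> start p\<close> 3(2) by force
  next
    case False
    then show ?thesis using 3(3) by auto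
  qed
qed auto

text \<open>Every processor has at most one entry in the queue. After a piece is placed, this entry
  is the finish of the piece, so later pieces on the same processor start no earlier.\<close>

lemma forward_disjoint:
  assumes "\<forall>x\<in>set xs. 0 < snd x" "distinct (map snd q)"
  shows "sorted_wrt (\<lambda>p p'. proc p = proc p' \<longrightarrow> finish p \<le> start p') (forward q xs)"
  using assms
proof (induction q xs rule: forward.induct)
  case (3 t i q j d xs)
  let ?q = "insort_key (\<lambda>(t, i). t) (t + d, i) q"
  have "mset (map snd ?q) = mset (map snd ((t + d, i) # q))"
    by simp
  then have dist: "distinct (map snd ?q)"
    using 3(3) by (metis mset_eq_imp_distinct_iff list.simps(9) snd_conv)
  have "t + d \<le> start p" if p: "p \<in> set (forward ?q xs)" "proc p = i" for p
  proof -
    obtain s where "(s, i) \<in> set ?q" "s \<le> start p"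
      using forward_from_queue[OF _ p(1)] 3(2) p(2) by auto
    then have "(s, i) = (t + d, i) \<or> (s, i) \<in> set q" by (auto simp: set_insort_key)
    then show ?thesis using 3(3) \<open>s \<le> start p\<close> by force
  qed
  then show ?case using 3 dist by auto
qed auto

text \<open>Graham's averaging argument: the head of the sorted queue is at most the average free
  time, and every placed job raises the sum of the free times by exactly its duration.\<close>

lemma forward_start_le_average:
  assumes "sorted (map fst q)" "q \<noteq> []" "k < length xs"
  shows "real (length q) * start (forward q xs ! k)
    \<le> sum_list (map fst q) + sum_list (map snd (take k xs))"
  using assms
proof (induction q xs arbitrary: k rule: forward.induct)
  case (3 t i q j d xs)
  let ?q = "insort_key (\<lambda>(t, i). t) (t + d, i) q"
  show ?case
  proof (cases k)
    case 0
    have "sum_list (map fst ((t, i) # q)) \<ge> sum_list (map (\<lambda>_. t) ((t, i) # q))"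
      using 3(2) by (intro sum_list_mono) auto
    then show ?thesis using 0 by (simp add: sum_list_triv algebra_simps)
  next
    case (Suc k')
    have "(\<lambda>(t, i). t) = (fst :: real \<times> nat \<Rightarrow> real)" by auto
    then have "sorted (map fst ?q)"
      using 3(2) by (simp add: sorted_insort_key)
    moreover have "mset (map fst ?q) = mset (map fst ((t + d, i) # q))"
      by simp
    then have "sum_list (map fst ?q) = sum_list (map fst ((t + d, i) # q))"
      by (metis sum_mset_sum_list)
    ultimately show ?thesis
      using 3(1)[of k'] 3(4) Suc by (simp add: insort_key_not_Nil)
  qed
qed auto

text \<open>With fewer jobs than processors, \<open>crd\<close> uses only as many processors as there are jobs, so the
  averaging bound is too weak; but then no job has to wait.\<close>

lemma forward_start_eq:
  assumes "sorted (map fst q)" "\<forall>x\<in>set q. R \<le> fst x" "\<forall>x\<in>set xs. 0 < snd x"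
    and "length xs \<le> length (filter (\<lambda>x. fst x = R) q)" "k < length xs"
  shows "start (forward q xs ! k) = R"
  using assms
proof (induction q xs arbitrary: k rule: forward.induct)
  case (3 t i q j d xs)
  let ?q = "insort_key (\<lambda>(t, i). t) (t + d, i) q"
  have "filter (\<lambda>x. fst x = R) ((t, i) # q) \<noteq> []" using 3(5) by auto
  then obtain x where "x \<in> set ((t, i) # q)" "fst x = R"
    by (metis (mono_tags, lifting) filter_False)
  then have t: "t = R" using 3(2,3) by force
  show ?case
  proof (cases k)
    case (Suc k')
    have "(\<lambda>(t, i). t) = (fst :: real \<times> nat \<Rightarrow> real)" by auto
    then have "sorted (map fst ?q)"
      using 3(2) by (simp add: sorted_insort_key)
    \<comment> \<open>The reinserted entry lies after \<open>R\<close> and is not counted. Each job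
      uses up one processor free at \<open>R\<close>, so the count hypothesis passes to the
      tail.\<close>
    moreover have "filter (\<lambda>x. fst x = R) ?q = filter (\<lambda>x. fst x = R) q"
      using 3(4) t by (intro filter_insort_triv) auto
    ultimately show ?thesis
      using 3(1)[of k'] 3(3-6) Suc t by (auto simp: set_insort_key)
  qed (use t in simp)
qed auto

text \<open>If no job waits, the bound on the single duration suffices. Otherwise the start is at
  most \<open>R + x / m\<close> for the total duration \<open>x\<close> of the preceding jobs, and
  \<open>load\<close> bounds \<open>x\<close> together with the job itself. The abstract
  \<open>due\<close> stands for the deadline in CRD and for the negated release date in CD.\<close>

lemma forward_meets_due:
  fixes due :: "job \<Rightarrow> real"
  assumes m: "1 \<le> m" and ys: "distinct ys" "sorted (map due ys)" and k: "k < length ys"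
    and dur: "\<forall>j\<in>set ys. 0 < dur j"
      "\<forall>j\<in>set ys. (2 - 1 / real m) * dur j \<le> due j - R"
    and load: "\<forall>J D. J \<subseteq> set ys \<longrightarrow> (\<forall>j\<in>J. due j \<le> D) \<longrightarrow> R \<le> D \<longrightarrow>
      (2 - 1 / real m) * (\<Sum>j\<in>J. dur j) \<le> real m * (D - R)"
  shows "start (forward (processors R (min m (length ys))) (map (\<lambda>j. (j, dur j)) ys) ! k)
    + dur (ys ! k) \<le> due (ys ! k)"
proof -
  define q where "q = processors R (min m (length ys))"
  define s where "s = start (forward q (map (\<lambda>j. (j, dur j)) ys) ! k)"
  define d where "d = dur (ys ! k)"
  define D where "D = due (ys ! k)"
  define c where "c = 2 - 1 / real m"
  have c: "1 \<le> c" using m by (simp add: c_def field_simps)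
  have d: "0 < d" "c * d \<le> D - R" using dur k by (auto simp: d_def c_def D_def)
  have sorted: "sorted (map fst q)" by (simp add: q_def processors_props)
  have "s + d \<le> D"
  proof (cases "length ys < m")
    case True
    have "filter (\<lambda>x. fst x = R) q = q" by (auto simp: q_def processors_props filter_id_conv)
    then have "s = R"
      unfolding s_def using True k dur sorted
      by (intro forward_start_eq) (auto simp: q_def processors_props)
    moreover have "1 * d \<le> c * d" using c d by (intro mult_right_mono) auto
    ultimately show ?thesis using d by linarith
  next
    case False
    define x where "x = sum_list (map dur (take k ys))"
    have lenq: "length q = m" using False by (simp add: q_def processors_props)
    then have "q \<noteq> []" using m by auto
    have "sum_list (map fst q) = real m * R"
      using False by (simp add: q_def processors_props sum_list_replicate)
    then have avg: "real m * s \<le> real m * R + x"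
      using forward_start_le_average[OF sorted \<open>q \<noteq> []\<close>, of k "map (\<lambda>j. (j, dur j)) ys"] k lenq
      by (auto simp: s_def x_def take_map comp_def)
    \<comment> \<open>The list is sorted by due date, so the jobs up to position \<open>k\<close>
      are all due by \<open>D\<close> and the load bound applies to them.\<close>
    have "due j \<le> D" if "j \<in> set (take (Suc k) ys)" for j
      using that k ys(2) unfolding D_def
      by (auto simp: in_set_conv_nth sorted_iff_nth_mono less_Suc_eq_le)
    moreover have "set (take (Suc k) ys) \<subseteq> set ys" by (rule set_take_subset)
    moreover have "0 \<le> c * d" using c d by simp
    then have "R \<le> D" using d by simp
    ultimately have "c * (\<Sum>j\<in>set (take (Suc k) ys). dur j) \<le> real m * (D - R)"
      unfolding c_def using load by blast
    moreover have "(\<Sum>j\<in>set (take (Suc k) ys). dur j) = sum_list (map dur (take (Suc k) ys))"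
      using ys(1) by (intro sum_list_distinct_conv_sum_set[symmetric]) simp
    moreover have "\<dots> = x + d"
      using k by (simp add: take_Suc_conv_app_nth x_def d_def)
    ultimately have "c * (x + d) \<le> real m * (D - R)" by simp
    \<comment> \<open>Adding \<open>m - 1\<close> times the bound for the single job turns
      \<open>x + d\<close> into \<open>x + m * d\<close>. As \<open>2 * m - 1 = c * m\<close>, the
      factor \<open>c\<close> then cancels; this is what dictates the value
      \<open>2 - 1 / m\<close>.\<close>
    moreover have "(real m - 1) * (c * d) \<le> (real m - 1) * (D - R)"
      using m d by (intro mult_left_mono) auto
    ultimately have "c * (x + real m * d) \<le> (2 * real m - 1) * (D - R)"
      by (simp add: algebra_simps)
    also have "2 * real m - 1 = c * real m" using m by (simp add: c_def field_simps)
    finally have "c * (x + real m * d) \<le> c * (real m * (D - R))" by (simp add: mult.assoc)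
    then have "x + real m * d \<le> real m * (D - R)" using c by (simp add: mult_le_cancel_left)
    then have "real m * (s + d) \<le> real m * D" using avg by (simp add: algebra_simps)
    then show ?thesis using m by (simp add: mult_le_cancel_left)
  qed
  then show ?thesis by (simp add: s_def d_def D_def q_def)
qed

section \<open>Time reversal\<close>

definition mirror :: "piece \<Rightarrow> piece" where
  "mirror p = p\<lparr>start := - finish p, finish := - start p\<rparr>"

lemma mirror_simps [simp]:
  "pjob (mirror p) = pjob p" "proc (mirror p) = proc p" "pspeed (mirror p) = pspeed p"
  "start (mirror p) = - finish p" "finish (mirror p) = - start p"
  "piece_data (mirror p) = piece_data p"
  by (simp_all add: mirror_def piece_data_def)

text \<open>Negating all times exchanges starts and finishes and turns the queue order by
  \<open>- t\<close> into the order by \<open>t\<close>. Scheduling backwards from \<open>D\<close>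
  thus becomes scheduling forwards from \<open>- D\<close>, and the forward lemmas carry
  over.\<close>

lemma backward_eq_mirror_forward:
  "backward q xs = map mirror (forward (map (\<lambda>(t, i). (- t, i)) q) xs)"
proof (induction q xs rule: backward.induct)
  case (3 t i q j d xs)
  have "map (\<lambda>(t, i). (- t, i)) (insort_key (\<lambda>(t, i). - t) (t - d, i) q)
      = insort_key (\<lambda>(t, i). t) (- t + d, i) (map (\<lambda>(t, i). (- t, i)) q)"
    by (induction q) auto
  then show ?case using 3 by (simp add: mirror_def)
qed auto

lemma processors_uminus: "map (\<lambda>(t, i). (- t, i)) (processors t n) = processors (- t) n"
  by (induction n) auto

section \<open>Correctness of CRD and CD\<close>

lemma cost_eq_sum:
  assumes "distinct ys" "map piece_data ps = map (\<lambda>j. (jid j, dur j, work j / dur j)) ys"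
  shows "cost \<alpha> ps = (\<Sum>j\<in>set ys. dur j * (work j / dur j) powr \<alpha>)"
proof -
  have "cost \<alpha> ps = sum_list (map (\<lambda>(k, l, s). l * s powr \<alpha>) (map piece_data ps))"
    by (simp add: cost_def piece_data_def comp_def)
  also have "\<dots> = sum_list (map (\<lambda>j. dur j * (work j / dur j) powr \<alpha>) ys)"
    by (simp add: assms(2) comp_def)
  finally show ?thesis using assms(1) by (simp add: sum_list_distinct_conv_sum_set)
qed

text \<open>The \<open>k\<close>-th piece serves the \<open>k\<close>-th job of \<open>ys\<close>,
  so windows can be checked by position. Disjointness allows either order in time, which covers
  mirrored lists, where later entries on a processor run earlier.\<close>

lemma nonpreemptive_piecesI:
  assumes valid: "valid_instance I" and ys: "distinct ys" "set ys = set I"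
    and data: "map piece_data ps = map (\<lambda>j. (jid j, dur j, work j / dur j)) ys"
    and dur: "\<And>j. j \<in> set I \<Longrightarrow> 0 < dur j"
    and proc: "\<And>p. p \<in> set ps \<Longrightarrow> proc p < m"
    and window: "\<And>k. k < length ys \<Longrightarrow>
      release (ys ! k) \<le> start (ps ! k) \<and> finish (ps ! k) \<le> deadline (ys ! k)"
    and disjoint: "sorted_wrt (\<lambda>p p'. proc p = proc p' \<longrightarrow> finish p \<le> start p' \<or> finish p' \<le> start p) ps"
  shows "nonpreemptive_pieces m I ps"
  unfolding nonpreemptive_pieces_def
proof (intro conjI ballI impI)
  have len: "length ps = length ys" using arg_cong[OF data, of length] by simp
  have "map fst (map piece_data ps) = map jid ys" by (simp add: data comp_def)
  then have jobs: "map pjob ps = map jid ys" by (simp add: piece_data_def comp_def)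
  show "distinct (map pjob ps)"
    using ys valid_instanceD(5)[OF valid] by (simp add: jobs distinct_map)
  show "pjob ` set ps = jid ` set I"
    using arg_cong[OF jobs, of set] ys(2) by simp
  fix p assume p: "p \<in> set ps"
  then show "proc p < m" by (rule proc)
  obtain k where k: "k < length ps" "p = ps ! k" using p by (auto simp: in_set_conv_nth)
  have pk: "piece_data p = (jid (ys ! k), dur (ys ! k), work (ys ! k) / dur (ys ! k))"
    using arg_cong[OF data, of "\<lambda>l. l ! k"] k len by simp
  {
    fix j assume j: "j \<in> set I" "pjob p = jid j"
    have "ys ! k \<in> set I" using nth_mem[of k ys] k(1) len ys(2) by simp
    moreover have "jid (ys ! k) = jid j" using pk j(2) by (simp add: piece_data_def)
    \<comment> \<open>Identifiers are unique, so the job named by the \<open>k\<close>-th piece is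
      the \<open>k\<close>-th job.\<close>
    ultimately have "ys ! k = j" using valid_instanceD(3)[OF valid _ j(1)] by blast
    then show "start p < finish p" "release j \<le> start p" "finish p \<le> deadline j"
      "pspeed p = work j / (finish p - start p)"
      using pk dur[OF j(1)] window[of k] k len by (auto simp: piece_data_def)
  }
  fix p' assume p': "p' \<in> set ps" "proc p = proc p'"
  obtain k' where k': "k' < length ps" "p' = ps ! k'" using p' by (auto simp: in_set_conv_nth)
  show "p = p' \<or> finish p \<le> start p' \<or> finish p' \<le> start p"
  proof (cases k k' rule: linorder_cases)
    case less
    then show ?thesis
      using sorted_wrt_nth_less[OF disjoint less] k k' p'(2) by simp
  next
    case greater
    then show ?thesis
      using sorted_wrt_nth_less[OF disjoint greater] k k' p'(2) by auto
  qed (use k k' in simp)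
qed

text \<open>Running for time \<open>e / c\<close> at constant speed costs exactly
  \<open>c powr (\<alpha> - 1)\<close> times the lower bound that \<open>job_energy_ge\<close> gives
  for a job executed for time \<open>e\<close>.\<close>

lemma scaled_cost_le_energy:
  assumes "1 < \<alpha>" "valid_instance I" "preemptive_feasible m I S" and c: "0 < c"
    and dur: "\<And>j. j \<in> set I \<Longrightarrow> dur j = measure lborel (busy m S (jid j)) / c"
  shows "ennreal (\<Sum>j\<in>set I. dur j * (work j / dur j) powr \<alpha>)
    \<le> ennreal (c powr (\<alpha> - 1)) * energy \<alpha> m I S"
proof -
  have job: "ennreal (dur j * (work j / dur j) powr \<alpha>)
      \<le> ennreal (c powr (\<alpha> - 1)) * job_energy \<alpha> m S (jid j)" if j: "j \<in> set I" for j
  proof -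
    define e where "e = measure lborel (busy m S (jid j))"
    have e: "0 < e" using measure_busy_pos[OF assms(2,3) j] by (simp add: e_def)
    have w: "0 < work j" using valid_instanceD(1)[OF assms(2) j] .
    have d: "dur j = e / c" using dur[OF j] by (simp add: e_def)
    have "dur j * (work j / dur j) powr \<alpha> = work j * (work j / dur j) powr (\<alpha> - 1)"
      using e w c by (simp add: d powr_diff field_simps)
    also have "(work j / dur j) powr (\<alpha> - 1) = (c * (work j / e)) powr (\<alpha> - 1)"
      by (simp add: d mult.commute)
    also have "(c * (work j / e)) powr (\<alpha> - 1) = c powr (\<alpha> - 1) * (work j / e) powr (\<alpha> - 1)"
      by (rule powr_mult)
    finally have "ennreal (dur j * (work j / dur j) powr \<alpha>)
        = ennreal (c powr (\<alpha> - 1) * (work j * (work j / e) powr (\<alpha> - 1)))"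
      by (simp only: mult_ac)
    also have "\<dots> = ennreal (c powr (\<alpha> - 1)) * ennreal (work j * (work j / e) powr (\<alpha> - 1))"
      using w by (intro ennreal_mult) auto
    also have "\<dots> \<le> ennreal (c powr (\<alpha> - 1)) * job_energy \<alpha> m S (jid j)"
      using job_energy_ge[OF assms(1-3) j] by (intro mult_left_mono) (auto simp: e_def)
    finally show ?thesis .
  qed
  have "ennreal (\<Sum>j\<in>set I. dur j * (work j / dur j) powr \<alpha>)
      = (\<Sum>j\<in>set I. ennreal (dur j * (work j / dur j) powr \<alpha>))"
    using dur c by (intro sum_ennreal[symmetric]) simp
  also have "\<dots> \<le> (\<Sum>j\<in>set I. ennreal (c powr (\<alpha> - 1)) * job_energy \<alpha> m S (jid j))"
    using job by (rule sum_mono)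
  finally show ?thesis
    by (simp add: energy_eq_sum_job_energy[OF assms(2,3)] sum_distrib_left)
qed

context
  fixes \<alpha> :: real and opt :: algorithm and m :: nat and I :: "job list"
  assumes \<alpha>: "1 < \<alpha>" and m: "1 \<le> m" and valid: "valid_instance I"
    and wf: "well_formed (opt m I)" and feasible: "preemptive_feasible m I (schedule_of (opt m I))"
begin

definition duration :: "job \<Rightarrow> real" where
  "duration j = exec_time (jid j) (opt m I) / (2 - 1 / real m)"

lemma factor_pos: "0 < 2 - 1 / real m"
  using m by (simp add: field_simps)

lemma duration_eq: "duration j = measure lborel (busy m (schedule_of (opt m I)) (jid j)) / (2 - 1 / real m)"
  by (simp add: duration_def exec_time_eq_measure[OF wf feasible])

lemma duration_pos: "j \<in> set I \<Longrightarrow> 0 < duration j"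
  using measure_busy_pos[OF valid feasible] factor_pos by (simp add: duration_eq)

lemma duration_le: "j \<in> set I \<Longrightarrow> (2 - 1 / real m) * duration j \<le> deadline j - release j"
  using measure_busy_le_window[OF valid feasible] factor_pos by (simp add: duration_eq)

lemma sum_duration_le:
  assumes "J \<subseteq> set I" "\<And>j. j \<in> J \<Longrightarrow> a \<le> release j" "\<And>j. j \<in> J \<Longrightarrow> deadline j \<le> b" "a \<le> b"
  shows "(2 - 1 / real m) * (\<Sum>j\<in>J. duration j) \<le> real m * (b - a)"
  using sum_measure_busy_le[OF valid feasible assms] factor_pos
  by (simp add: duration_eq sum_divide_distrib[symmetric])

lemma sort_durations:
  "sort_key (\<lambda>(j, p). f j) (durations m (opt m I) I) = map (\<lambda>j. (j, duration j)) (sort_key f I)"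
  using map_sort_key[of "\<lambda>j. (j, duration j)" "\<lambda>(j, p). f j" I] by (simp add: durations_def duration_def)

text \<open>Common core of CRD and CD, which differ only in the sort key \<open>due\<close>, the
  origin \<open>R\<close> and the direction of time.\<close>

lemma list_schedule_correct:
  fixes due :: "job \<Rightarrow> real"
  assumes "\<forall>j\<in>set I. (2 - 1 / real m) * duration j \<le> due j - R"
    and "\<forall>J D. J \<subseteq> set I \<longrightarrow> (\<forall>j\<in>J. due j \<le> D) \<longrightarrow> R \<le> D \<longrightarrow>
      (2 - 1 / real m) * (\<Sum>j\<in>J. duration j) \<le> real m * (D - R)"
  defines "ys \<equiv> sort_key due I"
  defines "ps \<equiv> forward (processors R (min m (length I)))
    (sort_key (\<lambda>(j, p). due j) (durations m (opt m I) I))"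
  shows "map piece_data ps = map (\<lambda>j. (jid j, duration j, work j / duration j)) ys"
    and "\<And>p. p \<in> set ps \<Longrightarrow> proc p < m \<and> R \<le> start p"
    and "\<And>k. k < length ys \<Longrightarrow> finish (ps ! k) \<le> due (ys ! k)"
    and "sorted_wrt (\<lambda>p p'. proc p = proc p' \<longrightarrow> finish p \<le> start p') ps"
proof -
  define q where "q = processors R (min m (length I))"
  have ps: "ps = forward q (map (\<lambda>j. (j, duration j)) ys)"
    by (simp add: ps_def q_def ys_def sort_durations)
  have ys: "set ys = set I" "length ys = length I" by (simp_all add: ys_def)
  have "distinct I" using valid_instanceD(4)[OF valid] by (simp add: distinct_map)
  then have dist: "distinct ys" by (simp add: ys_def)
  have pos: "\<forall>x\<in>set (map (\<lambda>j. (j, duration j)) ys). 0 < snd x"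
    using duration_pos ys(1) by auto
  \<comment> \<open>The queue has \<open>min m (length I)\<close> entries and \<open>m\<close> is
    positive, so it is empty only if there are no jobs.\<close>
  have "q \<noteq> [] \<or> ys = []"
    using m ys(2) processors_props(1)[of R "min m (length I)"] unfolding q_def
    by (cases I) auto
  then show data: "map piece_data ps = map (\<lambda>j. (jid j, duration j, work j / duration j)) ys"
    using piece_data_forward[of q "map (\<lambda>j. (j, duration j)) ys"] by (simp add: ps comp_def)
  show "proc p < m \<and> R \<le> start p" if "p \<in> set ps" for p
    using forward_from_queue[OF pos] that
    by (fastforce simp: ps q_def processors_props)
  show "finish (ps ! k) \<le> due (ys ! k)" if k: "k < length ys" for k
  proof -
    have "start (ps ! k) + duration (ys ! k) \<le> due (ys ! k)"
      using forward_meets_due[OF m dist _ k, of due duration R] assms(1,2) duration_pos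
      unfolding ps q_def ys(1) ys(2)[symmetric] by (simp add: ys_def)
    moreover have "length ps = length ys" using arg_cong[OF data, of length] by simp
    then have "finish (ps ! k) - start (ps ! k) = duration (ys ! k)"
      using arg_cong[OF data, of "\<lambda>l. l ! k"] k by (simp add: piece_data_def)
    ultimately show ?thesis by simp
  qed
  show "sorted_wrt (\<lambda>p p'. proc p = proc p' \<longrightarrow> finish p \<le> start p') ps"
    unfolding ps using pos by (intro forward_disjoint) (simp_all add: q_def processors_props)
qed

lemma cost_le_energy:
  assumes "map piece_data ps = map (\<lambda>j. (jid j, duration j, work j / duration j)) (sort_key f I)"
  shows "ennreal (cost \<alpha> ps)
    \<le> ennreal ((2 - 1 / real m) powr (\<alpha> - 1)) * energy \<alpha> m I (schedule_of (opt m I))"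
proof -
  have "distinct I" using valid_instanceD(4)[OF valid] by (simp add: distinct_map)
  then have "cost \<alpha> ps = (\<Sum>j\<in>set I. duration j * (work j / duration j) powr \<alpha>)"
    using cost_eq_sum[OF _ assms] by simp
  then show ?thesis using scaled_cost_le_energy[OF \<alpha> valid feasible factor_pos duration_eq] by simp
qed

lemma crd_correct:
  assumes R: "\<And>j. j \<in> set I \<Longrightarrow> release j = R"
  shows "nonpreemptive_pieces m I (crd opt R m I)"
    and "\<And>p. p \<in> set (crd opt R m I) \<Longrightarrow> R \<le> start p"
    and "ennreal (cost \<alpha> (crd opt R m I))
      \<le> ennreal ((2 - 1 / real m) powr (\<alpha> - 1)) * energy \<alpha> m I (schedule_of (opt m I))"
proof -
  have due: "\<forall>j\<in>set I. (2 - 1 / real m) * duration j \<le> deadline j - R"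
    using duration_le R by fastforce
  \<comment> \<open>All jobs are released at \<open>R\<close>, so those due by \<open>D\<close> are
    executed within \<open>{R..D}\<close> in the preemptive schedule and the capacity bound
    applies.\<close>
  have load: "\<forall>J D. J \<subseteq> set I \<longrightarrow> (\<forall>j\<in>J. deadline j \<le> D) \<longrightarrow> R \<le> D \<longrightarrow>
      (2 - 1 / real m) * (\<Sum>j\<in>J. duration j) \<le> real m * (D - R)"
    using R by (intro allI impI sum_duration_le) auto
  note * = list_schedule_correct[of deadline R, OF due load, folded crd_def]
  have len: "length (crd opt R m I) = length (sort_key deadline I)"
    using arg_cong[OF *(1), of length] by simp
  have dist: "distinct (sort_key deadline I)"
    using valid_instanceD(4)[OF valid] by (simp add: distinct_map)
  have "release (sort_key deadline I ! k) \<le> start (crd opt R m I ! k)"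
    if "k < length (sort_key deadline I)" for k
  proof -
    have "sort_key deadline I ! k \<in> set (sort_key deadline I)" using that by (rule nth_mem)
    then show ?thesis using R *(2)[of "crd opt R m I ! k"] that len by simp
  qed
  moreover have "sorted_wrt (\<lambda>p p'. proc p = proc p' \<longrightarrow>
      finish p \<le> start p' \<or> finish p' \<le> start p) (crd opt R m I)"
    using *(4) by (rule sorted_wrt_mono_rel[rotated]) blast
  ultimately show "nonpreemptive_pieces m I (crd opt R m I)"
    using *(1-3) duration_pos by (intro nonpreemptive_piecesI[OF valid dist]) auto
  show "ennreal (cost \<alpha> (crd opt R m I))
      \<le> ennreal ((2 - 1 / real m) powr (\<alpha> - 1)) * energy \<alpha> m I (schedule_of (opt m I))"
    using cost_le_energy[OF *(1)] .
  show "R \<le> start p" if "p \<in> set (crd opt R m I)" for p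
    using *(2)[OF that] by blast
qed

lemma cd_correct:
  assumes D: "\<And>j. j \<in> set I \<Longrightarrow> deadline j = D"
  shows "nonpreemptive_pieces m I (cd opt D m I)"
    and "\<And>p. p \<in> set (cd opt D m I) \<Longrightarrow> finish p \<le> D"
    and "ennreal (cost \<alpha> (cd opt D m I))
      \<le> ennreal ((2 - 1 / real m) powr (\<alpha> - 1)) * energy \<alpha> m I (schedule_of (opt m I))"
proof -
  \<comment> \<open>Reversed in time, release dates become due dates and the common deadline
    \<open>D\<close> becomes the common release date \<open>- D\<close>.\<close>
  define due where "due j = - release j" for j :: job
  define ps where "ps = forward (processors (- D) (min m (length I)))
    (sort_key (\<lambda>(j, p). due j) (durations m (opt m I) I))"
  have cd: "cd opt D m I = map mirror ps"
    by (simp add: cd_def ps_def due_def backward_eq_mirror_forward processors_uminus)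
  have le: "\<forall>j\<in>set I. (2 - 1 / real m) * duration j \<le> due j - (- D)"
    using duration_le D by (fastforce simp: due_def)
  have load: "\<forall>J b. J \<subseteq> set I \<longrightarrow> (\<forall>j\<in>J. due j \<le> b) \<longrightarrow> - D \<le> b \<longrightarrow>
      (2 - 1 / real m) * (\<Sum>j\<in>J. duration j) \<le> real m * (b - (- D))"
  proof (intro allI impI)
    fix J b assume "J \<subseteq> set I" "\<forall>j\<in>J. due j \<le> b" "- D \<le> b"
    \<comment> \<open>A job with \<open>due j \<le> b\<close> is released no earlier than
      \<open>- b\<close>, so the capacity bound is used on \<open>{- b..D}\<close>.\<close>
    then have "(2 - 1 / real m) * (\<Sum>j\<in>J. duration j) \<le> real m * (D - (- b))"
      using D by (intro sum_duration_le) (auto simp: due_def minus_le_iff)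
    then show "(2 - 1 / real m) * (\<Sum>j\<in>J. duration j) \<le> real m * (b - (- D))"
      by (simp add: add.commute)
  qed
  note * = list_schedule_correct[of due "- D", OF le load, folded ps_def]
  have data: "map piece_data (cd opt D m I)
      = map (\<lambda>j. (jid j, duration j, work j / duration j)) (sort_key due I)"
    using *(1) by (simp add: cd comp_def)
  have len: "length ps = length (sort_key due I)"
    using arg_cong[OF *(1), of length] by simp
  have dist: "distinct (sort_key due I)"
    using valid_instanceD(4)[OF valid] by (simp add: distinct_map)
  have "release (sort_key due I ! k) \<le> start (cd opt D m I ! k) \<and>
      finish (cd opt D m I ! k) \<le> deadline (sort_key due I ! k)"
    if "k < length (sort_key due I)" for k
  proof -
    have "sort_key due I ! k \<in> set (sort_key due I)" using that by (rule nth_mem)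
    then show ?thesis using D *(2)[of "ps ! k"] *(3)[OF that] that len by (simp add: cd due_def)
  qed
  moreover have "sorted_wrt (\<lambda>p p'. proc p = proc p' \<longrightarrow>
      finish p \<le> start p' \<or> finish p' \<le> start p) (cd opt D m I)"
    unfolding cd sorted_wrt_map using *(4) by (rule sorted_wrt_mono_rel[rotated]) auto
  ultimately show "nonpreemptive_pieces m I (cd opt D m I)"
    using data *(2) duration_pos by (intro nonpreemptive_piecesI[OF valid dist]) (auto simp: cd)
  show "finish p \<le> D" if "p \<in> set (cd opt D m I)" for p
    using that *(2) by (force simp: cd)
  show "ennreal (cost \<alpha> (cd opt D m I))
      \<le> ennreal ((2 - 1 / real m) powr (\<alpha> - 1)) * energy \<alpha> m I (schedule_of (opt m I))"
    using cost_le_energy[OF data] .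
qed

end

section \<open>Splitting a clique instance\<close>

lemma min_deadline_le: "j \<in> set I \<Longrightarrow> min_deadline I \<le> deadline j"
  by (induction I rule: min_deadline.induct) auto

lemma min_deadline_attained: "I \<noteq> [] \<Longrightarrow> \<exists>j\<in>set I. min_deadline I = deadline j"
  by (induction I rule: min_deadline.induct) (auto simp: min_def)

text \<open>Let \<open>j'\<close> attain the minimum. If it is released no later than
  \<open>j\<close>, the clique property applies; otherwise
  \<open>release j < release j' < deadline j'\<close>. Together with \<open>min_deadline_le\<close>
  this shows that moving a deadline or a release date to the minimum only shrinks windows.\<close>

lemma clique_release_le_min_deadline:
  assumes "valid_instance I" "clique_instance I" "j \<in> set I"
  shows "release j \<le> min_deadline I"
proof -
  have "I \<noteq> []" using assms(3) by auto
  then obtain j' where j': "j' \<in> set I" "min_deadline I = deadline j'"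
    using min_deadline_attained by blast
  show ?thesis
  proof (cases "release j' \<le> release j")
    case True
    then show ?thesis using assms j' unfolding clique_instance_def by auto
  next
    case False
    then show ?thesis using valid_instanceD(2)[OF assms(1) j'(1)] j'(2) by simp
  qed
qed

lemma cost_append: "cost \<alpha> (ps @ qs) = cost \<alpha> ps + cost \<alpha> qs"
  by (simp add: cost_def)

lemma nonpreemptive_piecesD:
  assumes "nonpreemptive_pieces m I ps"
  shows "distinct (map pjob ps)" and "pjob ` set ps = jid ` set I"
    and "p \<in> set ps \<Longrightarrow> j \<in> set I \<Longrightarrow> pjob p = jid j \<Longrightarrow>
      proc p < m \<and> start p < finish p \<and> release j \<le> start p \<and> finish p \<le> deadline j \<and>
      pspeed p = work j / (finish p - start p)"
    and "p \<in> set ps \<Longrightarrow> q \<in> set ps \<Longrightarrow> proc p = proc q \<Longrightarrow>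
      p = q \<or> finish p \<le> start q \<or> finish q \<le> start p"
  using assms unfolding nonpreemptive_pieces_def by metis+

text \<open>The time \<open>T\<close> separates the two schedules, so they may share processors. By
  \<open>sub\<close> the windows of both halves lie inside the original ones.\<close>

lemma nonpreemptive_pieces_append:
  assumes L: "nonpreemptive_pieces m IL ps" and R: "nonpreemptive_pieces m IR qs"
    and jobs: "jid ` set IL \<inter> jid ` set IR = {}" "jid ` set I = jid ` set IL \<union> jid ` set IR"
    and T: "\<And>p. p \<in> set ps \<Longrightarrow> finish p \<le> T" "\<And>q. q \<in> set qs \<Longrightarrow> T \<le> start q"
    and sub: "\<And>j j'. j \<in> set I \<Longrightarrow> j' \<in> set IL \<union> set IR \<Longrightarrow> jid j = jid j' \<Longrightarrow>
      work j = work j' \<and> release j \<le> release j' \<and> deadline j' \<le> deadline j"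
  shows "nonpreemptive_pieces m I (ps @ qs)"
proof -
  note imL = nonpreemptive_piecesD(2)[OF L] and imR = nonpreemptive_piecesD(2)[OF R]
  have "distinct (map pjob (ps @ qs))"
    using nonpreemptive_piecesD(1)[OF L] nonpreemptive_piecesD(1)[OF R] imL imR jobs(1) by simp
  moreover have "pjob ` set (ps @ qs) = jid ` set I"
    using imL imR jobs(2) by (simp add: image_Un)
  moreover have "proc p < m \<and> start p < finish p \<and> release j \<le> start p \<and> finish p \<le> deadline j \<and>
      pspeed p = work j / (finish p - start p)"
    if p: "p \<in> set (ps @ qs)" and j: "j \<in> set I" "pjob p = jid j" for p j
  proof -
    have "\<exists>j'\<in>set IL \<union> set IR. jid j = jid j' \<and> proc p < m \<and> start p < finish p \<and>
      release j' \<le> start p \<and> finish p \<le> deadline j' \<and> pspeed p = work j' / (finish p - start p)"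
    proof (cases "p \<in> set ps")
      case True
      then have "jid j \<in> jid ` set IL" using imL j(2) by (metis imageI)
      then obtain j' where "j' \<in> set IL" "jid j = jid j'" by blast
      then show ?thesis using nonpreemptive_piecesD(3)[OF L True, of j'] j(2)
        by (intro bexI[of _ j']) auto
    next
      case False
      then have qs: "p \<in> set qs" using p by simp
      then have "jid j \<in> jid ` set IR" using imR j(2) by (metis imageI)
      then obtain j' where "j' \<in> set IR" "jid j = jid j'" by blast
      then show ?thesis using nonpreemptive_piecesD(3)[OF R qs, of j'] j(2)
        by (intro bexI[of _ j']) auto
    qed
    then show ?thesis using sub[OF j(1)] by force
  qed
  moreover have "p = q \<or> finish p \<le> start q \<or> finish q \<le> start p"
    if pq: "p \<in> set (ps @ qs)" "q \<in> set (ps @ qs)" "proc p = proc q" for p q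
  proof -
    consider "p \<in> set ps" "q \<in> set ps" | "p \<in> set qs" "q \<in> set qs"
      | "p \<in> set ps" "q \<in> set qs" | "p \<in> set qs" "q \<in> set ps"
      using pq(1,2) by auto
    then show ?thesis
    proof cases
      case 1 then show ?thesis using nonpreemptive_piecesD(4)[OF L] pq(3) by blast
    next
      case 2 then show ?thesis using nonpreemptive_piecesD(4)[OF R] pq(3) by blast
    next
      case 3 then show ?thesis using T(1)[of p] T(2)[of q] by simp
    next
      case 4 then show ?thesis using T(1)[of q] T(2)[of p] by simp
    qed
  qed
  ultimately show ?thesis unfolding nonpreemptive_pieces_def by (intro conjI ballI impI) simp_all
qed

section \<open>Execution before and after the split point\<close>

context
  fixes m :: nat and I :: "job list" and ps :: "piece list" and T :: real
  assumes valid: "valid_instance I"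
    and wf: "well_formed ps" and feasible: "preemptive_feasible m I (schedule_of ps)"
begin

lemma exec_before_plus_after:
  assumes "j \<in> set I"
  shows "exec_before T (jid j) ps + exec_after T (jid j) ps
    = measure lborel (busy m (schedule_of ps) (jid j))"
proof -
  let ?X = "busy m (schedule_of ps) (jid j)"
  have X: "?X \<in> sets borel" using busy_measurable[OF feasible] .
  have bd: "bounded ?X"
    using bounded_subset[OF bounded_closed_interval busy_subset_window[OF valid feasible assms]] .
  have "measure lborel ((?X \<inter> {..<T}) \<union> (?X \<inter> {T..}))
      = measure lborel (?X \<inter> {..<T}) + measure lborel (?X \<inter> {T..})"
  proof (rule measure_Un2[THEN trans])
    have "?X \<inter> {T..} - ?X \<inter> {..<T} = ?X \<inter> {T..}" by auto
    then show "measure lborel (?X \<inter> {..<T}) + measure lborel (?X \<inter> {T..} - ?X \<inter> {..<T})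
        = measure lborel (?X \<inter> {..<T}) + measure lborel (?X \<inter> {T..})" by simp
  qed (use X bd in \<open>auto intro!: fmeasurable_lborel_bounded intro: bounded_Int\<close>)
  moreover have "(?X \<inter> {..<T}) \<union> (?X \<inter> {T..}) = ?X" by auto
  ultimately show ?thesis
    by (simp add: exec_before_eq_measure[OF wf feasible] exec_after_eq_measure[OF wf feasible])
qed

text \<open>A job released at or after \<open>T\<close> cannot run before \<open>T\<close>. This
  keeps the windows of the left instance from degenerating when deadlines are set to
  \<open>T\<close>.\<close>

lemma release_less_if_executed_before:
  assumes "j \<in> set I" "0 < exec_before T (jid j) ps"
  shows "release j < T"
proof (rule ccontr)
  assume "\<not> release j < T"
  then have "busy m (schedule_of ps) (jid j) \<inter> {..<T} = {}"
    using busy_subset_window[OF valid feasible assms(1)] by fastforce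
  then show False using assms(2) by (simp add: exec_before_eq_measure[OF wf feasible])
qed

lemma less_deadline_if_executed_after:
  assumes "j \<in> set I" "0 < exec_after T (jid j) ps"
  shows "T < deadline j"
proof (rule ccontr)
  assume "\<not> T < deadline j"
  \<comment> \<open>Only the single point \<open>T\<close> could remain, and it has measure
    0.\<close>
  then have "busy m (schedule_of ps) (jid j) \<inter> {T..} \<subseteq> {T..T}"
    using busy_subset_window[OF valid feasible assms(1)] by fastforce
  then have "measure lborel (busy m (schedule_of ps) (jid j) \<inter> {T..}) \<le> T - T"
    using busy_measurable[OF feasible] by (intro measure_subset_interval) auto
  then show False using assms(2) by (simp add: exec_after_eq_measure[OF wf feasible])
qed

text \<open>The two parts add up to a positive total, so the larger part is positive and at least
  half of it. Ties count as left.\<close>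

lemma left_job_executed_before:
  assumes "j \<in> set (left_jobs T ps I)"
  shows "j \<in> set I" "0 < exec_before T (jid j) ps"
    "measure lborel (busy m (schedule_of ps) (jid j))
      \<le> 2 * measure lborel (busy m (schedule_of ps) (jid j) \<inter> {..<T})"
proof -
  have j: "j \<in> set I" and ge: "exec_after T (jid j) ps \<le> exec_before T (jid j) ps"
    using assms by (simp_all add: left_jobs_def)
  show "j \<in> set I" by fact
  show "0 < exec_before T (jid j) ps"
    using measure_busy_pos[OF valid feasible j] exec_before_plus_after[OF j] ge by linarith
  show "measure lborel (busy m (schedule_of ps) (jid j))
      \<le> 2 * measure lborel (busy m (schedule_of ps) (jid j) \<inter> {..<T})"
    using exec_before_plus_after[OF j] ge by (simp add: exec_before_eq_measure[OF wf feasible])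
qed

lemma right_job_executed_after:
  assumes "j \<in> set (right_jobs T ps I)"
  shows "j \<in> set I" "0 < exec_after T (jid j) ps"
    "measure lborel (busy m (schedule_of ps) (jid j))
      \<le> 2 * measure lborel (busy m (schedule_of ps) (jid j) \<inter> {T..})"
proof -
  have j: "j \<in> set I" and less: "exec_before T (jid j) ps < exec_after T (jid j) ps"
    using assms by (simp_all add: right_jobs_def)
  show "j \<in> set I" by fact
  show "0 < exec_after T (jid j) ps"
    using measure_busy_pos[OF valid feasible j] exec_before_plus_after[OF j] less by linarith
  show "measure lborel (busy m (schedule_of ps) (jid j))
      \<le> 2 * measure lborel (busy m (schedule_of ps) (jid j) \<inter> {T..})"
    using exec_before_plus_after[OF j] less by (simp add: exec_after_eq_measure[OF wf feasible])
qed

lemma valid_left_instance: "valid_instance (left_instance T ps I)"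
proof -
  have "map jid (left_instance T ps I) = map jid (left_jobs T ps I)"
    by (simp add: left_instance_def)
  moreover have "distinct (map jid (left_jobs T ps I))"
    using valid_instanceD(4)[OF valid] by (simp add: left_jobs_def distinct_map_filter)
  moreover have "0 < work j \<and> release j < deadline j" if "j \<in> set (left_instance T ps I)" for j
  proof -
    obtain j0 where j0: "j0 \<in> set (left_jobs T ps I)" "j = j0\<lparr>deadline := T\<rparr>"
      using \<open>j \<in> set (left_instance T ps I)\<close> by (auto simp: left_instance_def)
    then show ?thesis
      using left_job_executed_before[OF j0(1)] release_less_if_executed_before
        valid_instanceD(1)[OF valid] by simp
  qed
  ultimately show ?thesis by (simp add: valid_instance_def)
qed

lemma valid_right_instance: "valid_instance (right_instance T ps I)"
proof -
  have "map jid (right_instance T ps I) = map jid (right_jobs T ps I)"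
    by (simp add: right_instance_def)
  moreover have "distinct (map jid (right_jobs T ps I))"
    using valid_instanceD(4)[OF valid] by (simp add: right_jobs_def distinct_map_filter)
  moreover have "0 < work j \<and> release j < deadline j" if "j \<in> set (right_instance T ps I)" for j
  proof -
    obtain j0 where j0: "j0 \<in> set (right_jobs T ps I)" "j = j0\<lparr>release := T\<rparr>"
      using \<open>j \<in> set (right_instance T ps I)\<close> by (auto simp: right_instance_def)
    then show ?thesis
      using right_job_executed_after[OF j0(1)] less_deadline_if_executed_after
        valid_instanceD(1)[OF valid] by simp
  qed
  ultimately show ?thesis by (simp add: valid_instance_def)
qed

text \<open>Squeezing with \<open>B\<close> as the time before \<open>T\<close>: clipped there, the
  old window of a left job fits into the window with deadline \<open>T\<close>.\<close>

lemma exists_left_schedule: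
  assumes "1 < \<alpha>"
  shows "\<exists>S'. preemptive_feasible m (left_instance T ps I) S' \<and>
    energy \<alpha> m (left_instance T ps I) S'
      \<le> ennreal (2 powr (\<alpha> - 1)) *
        (\<Sum>j\<in>set (left_instance T ps I). job_energy \<alpha> m (schedule_of ps) (jid j))"
proof (rule exists_squeezed_schedule[OF assms valid feasible valid_left_instance, of "{..<T}"])
  fix j' assume "j' \<in> set (left_instance T ps I)"
  then obtain j where j: "j \<in> set (left_jobs T ps I)" "j' = j\<lparr>deadline := T\<rparr>"
    by (auto simp: left_instance_def)
  then show "\<exists>j\<in>set I. jid j = jid j' \<and> work j = work j' \<and>
      {release j..deadline j} \<inter> {..<T} \<subseteq> {release j'..deadline j'} \<and>
      measure lborel (busy m (schedule_of ps) (jid j))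
        \<le> 2 * measure lborel (busy m (schedule_of ps) (jid j) \<inter> {..<T})"
    using left_job_executed_before[OF j(1)] by (intro bexI[of _ j]) auto
qed simp

lemma exists_right_schedule:
  assumes "1 < \<alpha>"
  shows "\<exists>S'. preemptive_feasible m (right_instance T ps I) S' \<and>
    energy \<alpha> m (right_instance T ps I) S'
      \<le> ennreal (2 powr (\<alpha> - 1)) *
        (\<Sum>j\<in>set (right_instance T ps I). job_energy \<alpha> m (schedule_of ps) (jid j))"
proof (rule exists_squeezed_schedule[OF assms valid feasible valid_right_instance, of "{T..}"])
  fix j' assume "j' \<in> set (right_instance T ps I)"
  then obtain j where j: "j \<in> set (right_jobs T ps I)" "j' = j\<lparr>release := T\<rparr>"
    by (auto simp: right_instance_def)
  then show "\<exists>j\<in>set I. jid j = jid j' \<and> work j = work j' \<and>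
      {release j..deadline j} \<inter> {T..} \<subseteq> {release j'..deadline j'} \<and>
      measure lborel (busy m (schedule_of ps) (jid j))
        \<le> 2 * measure lborel (busy m (schedule_of ps) (jid j) \<inter> {T..})"
    using right_job_executed_after[OF j(1)] by (intro bexI[of _ j]) auto
qed simp

text \<open>Moving an endpoint changes the record but keeps its identifier, so the sums are compared
  over identifiers, which the left and right jobs partition.\<close>

lemma sum_left_right_instance:
  "(\<Sum>j\<in>set (left_instance T ps I). g (jid j)) + (\<Sum>j\<in>set (right_instance T ps I). g (jid j))
    = (\<Sum>j\<in>set I. g (jid j))" for g :: "nat \<Rightarrow> ennreal"
proof -
  have inj: "inj_on jid (set I)" using valid_instanceD(5)[OF valid] .
  have "(\<Sum>j\<in>set (left_instance T ps I). g (jid j)) = sum g (jid ` set (left_instance T ps I))"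
    by (simp add: sum.reindex[OF valid_instanceD(5)[OF valid_left_instance]])
  also have "jid ` set (left_instance T ps I) = jid ` set (left_jobs T ps I)"
    by (auto simp: left_instance_def image_image)
  also have "sum g \<dots> = (\<Sum>j\<in>set (left_jobs T ps I). g (jid j))"
    by (subst sum.reindex) (auto intro: inj_on_subset[OF inj] simp: left_jobs_def)
  finally have L: "(\<Sum>j\<in>set (left_instance T ps I). g (jid j))
      = (\<Sum>j\<in>set (left_jobs T ps I). g (jid j))" .
  have "(\<Sum>j\<in>set (right_instance T ps I). g (jid j)) = sum g (jid ` set (right_instance T ps I))"
    by (simp add: sum.reindex[OF valid_instanceD(5)[OF valid_right_instance]])
  also have "jid ` set (right_instance T ps I) = jid ` set (right_jobs T ps I)"
    by (auto simp: right_instance_def image_image)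
  also have "sum g \<dots> = (\<Sum>j\<in>set (right_jobs T ps I). g (jid j))"
    by (subst sum.reindex) (auto intro: inj_on_subset[OF inj] simp: right_jobs_def)
  finally have R: "(\<Sum>j\<in>set (right_instance T ps I). g (jid j))
      = (\<Sum>j\<in>set (right_jobs T ps I). g (jid j))" .
  have "set I = set (left_jobs T ps I) \<union> set (right_jobs T ps I)"
    "set (left_jobs T ps I) \<inter> set (right_jobs T ps I) = {}"
    by (auto simp: left_jobs_def right_jobs_def)
  then show ?thesis unfolding L R by (simp add: sum.union_disjoint)
qed

end

section \<open>Running times\<close>

lemma T_exec_eq:
  "T_exec_time k ps = length ps + 1" "T_exec_before T k ps = length ps + 1"
  "T_exec_after T k ps = length ps + 1"
  by (induction ps) auto

lemma T_processors_eq: "T_processors t n = n + 1"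
  by (induction n) auto

lemma T_min_deadline_le: "T_min_deadline I \<le> length I + 1"
  by (induction I rule: T_min_deadline.induct) auto

lemma T_insort_key_le: "T_insort_key f x xs \<le> length xs + 1"
  by (induction xs) auto

lemma T_sort_key_le: "T_sort_key f xs \<le> (length xs + 1) * (length xs + 1)"
proof (induction xs)
  case (Cons x xs)
  then show ?case using T_insort_key_le[of f x "sort_key f xs"] by simp
qed simp

text \<open>Reinsertion keeps the length of the queue, so each job costs at most one pass through a
  queue of the initial length.\<close>

lemma T_forward_le: "T_forward q xs \<le> length xs * (length q + 1) + 1"
proof (induction q xs rule: T_forward.induct)
  case (3 t i q j p xs)
  then show ?case using T_insort_key_le[of "\<lambda>(t, i). t" "(t + p, i)" q] by simp
qed auto

lemma T_backward_le: "T_backward q xs \<le> length xs * (length q + 1) + 1"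
proof (induction q xs rule: T_backward.induct)
  case (3 t i q j p xs)
  then show ?case using T_insort_key_le[of "\<lambda>(t, i). - t" "(t - p, i)" q] by simp
qed auto

lemma length_durations: "length (durations m ps js) = length js"
  by (simp add: durations_def)

lemma T_durations_eq: "T_durations m ps js = length js * (length ps + 1) + length js + 2"
  by (simp add: T_durations_def T_map T_exec_eq sum_list_triv)

text \<open>The costs \<open>s\<close> of sorting and \<open>f\<close> of scheduling are kept
  abstract to serve CRD and CD alike. The queue has at most \<open>length js\<close> entries, which
  keeps the bound free of \<open>m\<close>.\<close>

lemma list_schedule_time_le:
  assumes "t \<le> P" "length ps \<le> P" "length js \<le> n"
    and "s \<le> (length js + 1) * (length js + 1)" "f \<le> length js * (min m (length js) + 1) + 1"
  shows "t + T_durations m ps js + s + T_length js + T_processors R (min m (length js)) + f + 1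
    \<le> P + n * P + 2 * (n * n) + 7 * n + 8"
proof -
  have "length js * (length ps + 1) \<le> n * (P + 1)"
    using assms by (intro mult_le_mono) auto
  moreover have "length js * length js \<le> n * n"
    using assms by (intro mult_le_mono) auto
  moreover have "length js * (min m (length js) + 1) \<le> n * (n + 1)"
    using assms by (intro mult_le_mono) auto
  ultimately show ?thesis
    using assms by (simp add: T_durations_eq T_length T_processors_eq)
qed

lemma T_crd_le:
  assumes "T_opt m js \<le> P" "length (opt m js) \<le> P" "length js \<le> n"
  shows "T_crd opt T_opt R m js \<le> P + n * P + 2 * (n * n) + 7 * n + 8"
  unfolding T_crd_def Let_def using assms
  by (rule list_schedule_time_le)
    (metis T_sort_key_le length_durations,
     metis T_forward_le length_durations length_sort processors_props(1))

lemma T_cd_le: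
  assumes "T_opt m js \<le> P" "length (opt m js) \<le> P" "length js \<le> n"
  shows "T_cd opt T_opt D m js \<le> P + n * P + 2 * (n * n) + 7 * n + 8"
  unfolding T_cd_def Let_def using assms
  by (rule list_schedule_time_le)
    (metis T_sort_key_le length_durations,
     metis T_backward_le length_durations length_sort processors_props(1))

lemma length_crd_le: "length (crd opt R m js) \<le> length js"
  unfolding crd_def by (metis length_forward_le length_durations length_sort)

lemma length_cd_le: "length (cd opt D m js) \<le> length js"
  unfolding cd_def backward_eq_mirror_forward length_map
  by (metis length_forward_le length_durations length_sort)

lemma length_left_instance: "length (left_instance T ps I) \<le> length I"
  by (simp add: left_instance_def left_jobs_def)

lemma length_right_instance: "length (right_instance T ps I) \<le> length I"
  by (simp add: right_instance_def right_jobs_def)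

lemma T_left_instance_le:
  "T_left_instance T ps I \<le> 2 * (length I * (length ps + 1)) + 2 * length I + 4"
proof -
  have "length (left_jobs T ps I) \<le> length I" by (simp add: left_jobs_def)
  then show ?thesis
    by (simp add: T_left_instance_def T_left_jobs_def T_filter T_map T_exec_eq sum_list_triv
        algebra_simps)
qed

lemma T_right_instance_le:
  "T_right_instance T ps I \<le> 2 * (length I * (length ps + 1)) + 2 * length I + 4"
proof -
  have "length (right_jobs T ps I) \<le> length I" by (simp add: right_jobs_def)
  then show ?thesis
    by (simp add: T_right_instance_def T_right_jobs_def T_filter T_map T_exec_eq sum_list_triv
        algebra_simps)
qed

lemma T_cl_le:
  assumes "optimal_preemptive_algorithm \<alpha> opt T_opt"
  shows "\<exists>P d. \<forall>m I. 1 \<le> m \<longrightarrow> valid_instance I \<longrightarrow>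
    T_cl opt T_opt m I + length (cl opt m I) \<le> P * (length I + 1) ^ d"
proof -
  obtain c d where cd: "T_opt m I + length (opt m I) \<le> c * (length I + 1) ^ d"
    if "1 \<le> m" "valid_instance I" for m I
    using assms unfolding optimal_preemptive_algorithm_def polynomial_time_def by metis
  have opt: "well_formed (opt m I)" "preemptive_feasible m I (schedule_of (opt m I))"
    if "1 \<le> m" "valid_instance I" for m I
    using assms that unfolding optimal_preemptive_algorithm_def by metis+
  \<comment> \<open>Scanning the pieces for every job and sorting cost at most a quadratic factor in
    the number of jobs plus one, whence \<open>d + 2\<close>. Using \<open>c + 1\<close> makes the
    bound on the subroutine positive, and 100 is a generous constant.\<close>
  have "T_cl opt T_opt m I + length (cl opt m I) \<le> 100 * (c + 1) * (length I + 1) ^ (d + 2)"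
    if m: "1 \<le> m" and valid: "valid_instance I" for m I
  proof -
    define n P X where "n = length I" and "P = (c + 1) * (n + 1) ^ d" and "X = P * (n + 1) ^ 2"
    define T ps where "T = min_deadline I" and "ps = opt m I"
    define IL IR where "IL = left_instance T ps I" and "IR = right_instance T ps I"
    have len: "length IL \<le> n" "length IR \<le> n"
      using length_left_instance length_right_instance by (simp_all add: IL_def IR_def n_def)
    \<comment> \<open>The time bound of \<open>opt\<close> is available on valid instances, so its
      calls on the two halves need their validity.\<close>
    have valid_LR: "valid_instance IL" "valid_instance IR"
      using valid_left_instance[OF valid opt[OF m valid]] valid_right_instance[OF valid opt[OF m valid]]
      by (simp_all add: IL_def IR_def ps_def)
    have bound: "T_opt m J + length (opt m J) \<le> P" if "valid_instance J" "length J \<le> n" for J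
    proof -
      have "T_opt m J + length (opt m J) \<le> c * (length J + 1) ^ d" using cd[OF m that(1)] .
      also have "\<dots> \<le> (c + 1) * (n + 1) ^ d" using that(2) by (intro mult_le_mono power_mono) auto
      finally show ?thesis by (simp add: P_def)
    qed
    have bI: "T_opt m I \<le> P" "length ps \<le> P"
      using bound[OF valid] by (simp_all add: n_def ps_def)
    have bL: "T_opt m IL \<le> P" "length (opt m IL) \<le> P" using bound[OF valid_LR(1) len(1)] by simp_all
    have bR: "T_opt m IR \<le> P" "length (opt m IR) \<le> P" using bound[OF valid_LR(2) len(2)] by simp_all
    have "1 \<le> (n + 1) ^ d" by simp
    then have "1 * 1 \<le> (c + 1) * (n + 1) ^ d" by (intro mult_le_mono) auto
    then have P1: "1 \<le> P" by (simp add: P_def)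
    have X: "X = P * (n * n) + 2 * (n * P) + P"
      by (simp add: X_def power2_eq_square algebra_simps)
    \<comment> \<open>Naming the products turns the final estimate into linear arithmetic.\<close>
    define nP nn where "nP = n * P" and "nn = n * n"
    define Pnn inst where "Pnn = P * nn" and "inst = n * (length ps + 1)"
    have nP: "n \<le> n * P" "n * n \<le> P * (n * n)" using P1 by simp_all
    have "n * (length ps + 1) \<le> n * (P + 1)" using bI(2) by (intro mult_le_mono) auto
    then have inst: "n * (length ps + 1) \<le> n * P + n" by simp
    have cl: "cl opt m I = cd opt T m IL @ crd opt T m IR"
      by (simp add: cl_def Let_def T_def ps_def IL_def IR_def)
    have lens: "length (cd opt T m IL) \<le> n" "length (crd opt T m IR) \<le> n"
      using length_cd_le[of opt T m IL] length_crd_le[of opt T m IR] len by simp_all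
    have "T_cl opt T_opt m I = T_min_deadline I + T_opt m I + T_left_instance T ps I
        + T_right_instance T ps I + T_cd opt T_opt T m IL + T_crd opt T_opt T m IR
        + (length (cd opt T m IL) + 1) + 1"
      by (simp add: T_cl_def Let_def T_def ps_def IL_def IR_def T_append)
    moreover have "length (cl opt m I) = length (cd opt T m IL) + length (crd opt T m IR)"
      by (simp add: cl)
    ultimately have "T_cl opt T_opt m I + length (cl opt m I) \<le> 100 * X"
      using T_min_deadline_le[of I] T_left_instance_le[of T ps I] T_right_instance_le[of T ps I]
        T_cd_le[of T_opt m IL P opt n T, OF bL len(1)]
        T_crd_le[of T_opt m IR P opt n T, OF bR len(2)] bI(1) lens inst nP P1
      unfolding X n_def[symmetric] nP_def[symmetric] nn_def[symmetric] Pnn_def[symmetric]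
        inst_def[symmetric] by simp
    also have "100 * X = 100 * (c + 1) * (length I + 1) ^ (d + 2)"
      by (simp only: X_def P_def n_def power_add mult.assoc)
    finally show ?thesis .
  qed
  then show ?thesis by blast
qed

section \<open>Combining the two halves\<close>

theorem theorem3:
  fixes \<alpha> :: real and opt :: algorithm and T_opt :: running_time
  assumes "\<alpha> > 1"
    and "optimal_preemptive_algorithm \<alpha> opt T_opt"
  shows "approximation_algorithm \<alpha> clique_instance
           (\<lambda>m. (2 * (2 - 1 / real m)) powr (\<alpha> - 1)) (cl opt) (T_cl opt T_opt)"
  unfolding approximation_algorithm_def
proof (intro conjI allI impI)
  show "polynomial_time clique_instance (cl opt) (T_cl opt T_opt)"
    using T_cl_le[OF assms(2)] unfolding polynomial_time_def by blast
  fix m :: nat and I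
  assume m: "1 \<le> m" and valid: "valid_instance I" and clique: "clique_instance I"
  have opt: "well_formed (opt m J)" "preemptive_feasible m J (schedule_of (opt m J))"
    "\<And>S. preemptive_feasible m J S \<Longrightarrow> energy \<alpha> m J (schedule_of (opt m J)) \<le> energy \<alpha> m J S"
    if "valid_instance J" for J
    using assms(2) m that unfolding optimal_preemptive_algorithm_def by metis+
  define T ps where "T = min_deadline I" and "ps = opt m I"
  define IL IR where "IL = left_instance T ps I" and "IR = right_instance T ps I"
  define c where "c = 2 - 1 / real m"
  note wf = opt(1)[OF valid, folded ps_def] and feasible = opt(2)[OF valid, folded ps_def]
  have validL: "valid_instance IL" and validR: "valid_instance IR"
    using valid_left_instance[OF valid wf feasible] valid_right_instance[OF valid wf feasible]
    by (simp_all add: IL_def IR_def)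
  have dL: "\<And>j. j \<in> set IL \<Longrightarrow> deadline j = T" and rR: "\<And>j. j \<in> set IR \<Longrightarrow> release j = T"
    by (auto simp: IL_def IR_def left_instance_def right_instance_def)
  note L = cd_correct[where opt = opt and m = m and I = IL,
      OF assms(1) m validL opt(1,2)[OF validL] dL, folded c_def]
  note R = crd_correct[where opt = opt and m = m and I = IR,
      OF assms(1) m validR opt(1,2)[OF validR] rR, folded c_def]
  have cl: "cl opt m I = cd opt T m IL @ crd opt T m IR"
    by (simp add: cl_def Let_def T_def ps_def IL_def IR_def)
  have np: "nonpreemptive_pieces m I (cl opt m I)"
    unfolding cl
  proof (rule nonpreemptive_pieces_append[OF L(1) R(1) _ _ L(2) R(2)])
    show "jid ` set IL \<inter> jid ` set IR = {}"
      using valid_instanceD(3)[OF valid]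
      by (auto simp: IL_def IR_def left_instance_def right_instance_def left_jobs_def right_jobs_def)
    show "jid ` set I = jid ` set IL \<union> jid ` set IR"
      by (force simp: IL_def IR_def left_instance_def right_instance_def left_jobs_def
          right_jobs_def image_image)
    fix j j' assume j: "j \<in> set I" "j' \<in> set IL \<union> set IR" "jid j = jid j'"
    then obtain j0 where j0: "j0 \<in> set I" "j' = j0\<lparr>deadline := T\<rparr> \<or> j' = j0\<lparr>release := T\<rparr>"
      by (auto simp: IL_def IR_def left_instance_def right_instance_def left_jobs_def right_jobs_def)
    then have "jid j0 = jid j" using j(3) by auto
    then have "j0 = j" using valid_instanceD(3)[OF valid j0(1) j(1)] by blast
    \<comment> \<open>The split point lies between every release date and every deadline, so moving
      one endpoint to \<open>T\<close> shrinks the window.\<close>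
    then show "work j = work j' \<and> release j \<le> release j' \<and> deadline j' \<le> deadline j"
      using j0 min_deadline_le[OF j(1)] clique_release_le_min_deadline[OF valid clique j(1)]
      by (auto simp: T_def)
  qed
  show "well_formed (cl opt m I)" using nonpreemptive_pieces_well_formed[OF valid np] .
  show "nonpreemptive_feasible m I (schedule_of (cl opt m I))"
    using nonpreemptive_pieces_feasible[OF valid np] .
  fix S assume S: "nonpreemptive_feasible m I S"
  let ?E = "\<lambda>J. \<Sum>j\<in>set J. job_energy \<alpha> m (schedule_of ps) (jid j)"
  \<comment> \<open>The squeezed schedule is feasible for the left instance, so the optimal one
    computed inside CD is at most as expensive.\<close>
  have EL: "energy \<alpha> m IL (schedule_of (opt m IL)) \<le> ennreal (2 powr (\<alpha> - 1)) * ?E IL"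
    using exists_left_schedule[OF valid wf feasible assms(1), of T] opt(3)[OF validL]
    unfolding IL_def by (meson order_trans)
  have ER: "energy \<alpha> m IR (schedule_of (opt m IR)) \<le> ennreal (2 powr (\<alpha> - 1)) * ?E IR"
    using exists_right_schedule[OF valid wf feasible assms(1), of T] opt(3)[OF validR]
    unfolding IR_def by (meson order_trans)
  have cost_nonneg: "0 \<le> cost \<alpha> qs" if "nonpreemptive_pieces m J qs" "valid_instance J" for J qs
    unfolding cost_def
    using nonpreemptive_pieces_job[OF that(2,1)]
    by (intro sum_list_nonneg) (force intro!: mult_nonneg_nonneg)
  have "energy \<alpha> m I (schedule_of (cl opt m I)) = ennreal (cost \<alpha> (cl opt m I))"
    using nonpreemptive_pieces_energy[OF valid np assms(1)] .
  also have "\<dots> = ennreal (cost \<alpha> (cd opt T m IL)) + ennreal (cost \<alpha> (crd opt T m IR))"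
    unfolding cl cost_append
    using cost_nonneg[OF L(1) validL] cost_nonneg[OF R(1) validR] by (rule ennreal_plus)
  \<comment> \<open>List scheduling contributes the factor with base \<open>c\<close>, confining
    each job to one side of \<open>T\<close> the factor with base 2.\<close>
  also have "\<dots> \<le> ennreal (c powr (\<alpha> - 1)) * (ennreal (2 powr (\<alpha> - 1)) * ?E IL)
      + ennreal (c powr (\<alpha> - 1)) * (ennreal (2 powr (\<alpha> - 1)) * ?E IR)"
    using L(3) R(3) EL ER by (meson add_mono mult_left_mono order_trans zero_le)
  also have "\<dots> = ennreal (c powr (\<alpha> - 1)) * ennreal (2 powr (\<alpha> - 1)) * (?E IL + ?E IR)"
    by (simp add: algebra_simps)
  \<comment> \<open>Each job lies on exactly one side, so the two halves together are charged the
    preemptive energy of the whole instance only once.\<close>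
  also have "?E IL + ?E IR = ?E I"
    unfolding IL_def IR_def using sum_left_right_instance[OF valid wf feasible] .
  also have "ennreal (c powr (\<alpha> - 1)) * ennreal (2 powr (\<alpha> - 1)) = ennreal ((2 * c) powr (\<alpha> - 1))"
    by (simp add: ennreal_mult[symmetric] powr_mult mult.commute)
  also have "?E I = energy \<alpha> m I (schedule_of ps)"
    using energy_eq_sum_job_energy[OF valid feasible] by simp
  \<comment> \<open>A feasible non-preemptive schedule is also preemptively feasible, so the optimal
    preemptive energy bounds its energy from below.\<close>
  also have "ennreal ((2 * c) powr (\<alpha> - 1)) * \<dots> \<le> ennreal ((2 * c) powr (\<alpha> - 1)) * energy \<alpha> m I S"
    using opt(3)[OF valid, of S] S unfolding nonpreemptive_feasible_def ps_def
    by (intro mult_left_mono) auto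
  finally show "energy \<alpha> m I (schedule_of (cl opt m I))
      \<le> ennreal ((2 * (2 - 1 / real m)) powr (\<alpha> - 1)) * energy \<alpha> m I S"
    by (simp add: c_def)
qed

end
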